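(* Let $k$ be a field, $q\in k\setminus\{0\}$, and $\Lambda=\Lambda(q)$. An indecomposable $3$-dimensional torsionless left $\Lambda$-module is local.
   Context: $\Lambda=\Lambda(q)$ is the 6-dimensional local $k$-algebra generated by $x,y,z$ with relations $x^2=y^2=z^2=yz=0$, $xy+qyx=0$, $xz-zx=0$, $zy-zx=0$; it has $k$-basis $1,x,y,z,yx,zx$. A module is torsionless if it is isomorphic to a submodule of a projective module. A finite length module is local if its top $M/\operatorname{rad}M$ is simple. *)

theory Defs
  imports
    "HOL-Algebra.Algebraic_Closure_Type"
    "HOL-Library.Poly_Mapping"
    "Jordan_Normal_Form.Missing_VectorSpace"
begin

section \<open>Left modules over a not necessarily commutative ring\<close>

text \<open>
  The locale \<open>module\<close> of the library demands a commutative ring of scalars. The following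
  is the same axiom list over an arbitrary ring. As there, the ring multiplication and unit that
  the record type \<open>module\<close> carries for the module itself play no role; the modules
  constructed below leave these two fields undefined.
\<close>

locale left_module = R?: ring R + M?: abelian_group M
  for R :: "('a, 'b) ring_scheme" (structure) and M :: "('a, 'm, 'c) module_scheme" (structure) +
  assumes smult_closed: "\<lbrakk>a \<in> carrier R; x \<in> carrier M\<rbrakk> \<Longrightarrow> a \<odot>\<^bsub>M\<^esub> x \<in> carrier M"
    and smult_l_distr: "\<lbrakk>a \<in> carrier R; b \<in> carrier R; x \<in> carrier M\<rbrakk> \<Longrightarrow>
      (a \<oplus> b) \<odot>\<^bsub>M\<^esub> x = a \<odot>\<^bsub>M\<^esub> x \<oplus>\<^bsub>M\<^esub> b \<odot>\<^bsub>M\<^esub> x"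
    and smult_r_distr: "\<lbrakk>a \<in> carrier R; x \<in> carrier M; y \<in> carrier M\<rbrakk> \<Longrightarrow>
      a \<odot>\<^bsub>M\<^esub> (x \<oplus>\<^bsub>M\<^esub> y) = a \<odot>\<^bsub>M\<^esub> x \<oplus>\<^bsub>M\<^esub> a \<odot>\<^bsub>M\<^esub> y"
    and smult_assoc: "\<lbrakk>a \<in> carrier R; b \<in> carrier R; x \<in> carrier M\<rbrakk> \<Longrightarrow>
      (a \<otimes> b) \<odot>\<^bsub>M\<^esub> x = a \<odot>\<^bsub>M\<^esub> (b \<odot>\<^bsub>M\<^esub> x)"
    and smult_one: "x \<in> carrier M \<Longrightarrow> \<one> \<odot>\<^bsub>M\<^esub> x = x"

text \<open>
  Submodules are the library's \<open>Module.submodule\<close> (not the homonymous locale of the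
  theory \<open>LinearCombinations\<close>, which requires commutative scalars), and homomorphisms are
  the library's \<open>LinearCombinations.module_hom\<close>; neither definition uses commutativity.
\<close>

definition module_isomorphic ::
  "('a, 'b) ring_scheme \<Rightarrow> ('a, 'm, 'c) module_scheme \<Rightarrow> ('a, 'n, 'd) module_scheme \<Rightarrow> bool" where
  "module_isomorphic R M N \<longleftrightarrow>
     (\<exists>h \<in> LinearCombinations.module_hom R M N. bij_betw h (carrier M) (carrier N))"

definition internal_direct_sum ::
  "('a, 'b) ring_scheme \<Rightarrow> ('a, 'm, 'c) module_scheme \<Rightarrow> 'm set \<Rightarrow> 'm set \<Rightarrow> bool" where
  "internal_direct_sum R M N N' \<longleftrightarrow>
     Module.submodule N R M \<and> Module.submodule N' R M \<and>
     N <+>\<^bsub>M\<^esub> N' = carrier M \<and> N \<inter> N' = {\<zero>\<^bsub>M\<^esub>}"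

definition indecomposable_module ::
  "('a, 'b) ring_scheme \<Rightarrow> ('a, 'm, 'c) module_scheme \<Rightarrow> bool" where
  "indecomposable_module R M \<longleftrightarrow>
     left_module R M \<and> carrier M \<noteq> {\<zero>\<^bsub>M\<^esub>} \<and>
     (\<forall>N N'. internal_direct_sum R M N N' \<longrightarrow> N = {\<zero>\<^bsub>M\<^esub>} \<or> N' = {\<zero>\<^bsub>M\<^esub>})"

definition free_module :: "('a, 'b) ring_scheme \<Rightarrow> 'i set \<Rightarrow> ('a, 'i \<Rightarrow> 'a) module" where
  "free_module R I =
     \<lparr>carrier = {f \<in> I \<rightarrow>\<^sub>E carrier R. finite {i \<in> I. f i \<noteq> \<zero>\<^bsub>R\<^esub>}},
      monoid.mult = undefined,
      monoid.one = undefined,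
      ring.zero = (\<lambda>i\<in>I. \<zero>\<^bsub>R\<^esub>),
      ring.add = (\<lambda>f g. \<lambda>i\<in>I. f i \<oplus>\<^bsub>R\<^esub> g i),
      module.smult = (\<lambda>a f. \<lambda>i\<in>I. a \<otimes>\<^bsub>R\<^esub> f i)\<rparr>"

text \<open>
  A module is projective if it is isomorphic to a direct summand of a free module. Index sets in
  the element type of \<open>P\<close> suffice: \<open>P\<close> is a quotient of the free module on
  \<open>carrier P\<close>, and splits off from it if it is projective.
\<close>

definition projective_module ::
  "('a, 'b) ring_scheme \<Rightarrow> ('a, 'p, 'c) module_scheme \<Rightarrow> bool" where
  "projective_module R P \<longleftrightarrow>
     left_module R P \<and>
     (\<exists>(I :: 'p set) N N'. internal_direct_sum R (free_module R I) N N' \<and>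
        module_isomorphic R P ((free_module R I)\<lparr>carrier := N\<rparr>))"

text \<open>
  The type argument is the type of the elements of the ambient projective module, over which a
  definition cannot quantify existentially. A statement with hypothesis
  \<open>torsionless_module TYPE('p) R M\<close> for a type variable \<open>'p\<close> covers projective modules
  of every type.
\<close>

definition torsionless_module ::
  "'p itself \<Rightarrow> ('a, 'b) ring_scheme \<Rightarrow> ('a, 'm, 'c) module_scheme \<Rightarrow> bool" where
  "torsionless_module TYPE('p) R M \<longleftrightarrow>
     left_module R M \<and>
     (\<exists>(P :: ('a, 'p) module) N. projective_module R P \<and> Module.submodule N R P \<and>
        module_isomorphic R M (P\<lparr>carrier := N\<rparr>))"

definition quotient_module ::
  "('a, 'm, 'c) module_scheme \<Rightarrow> 'm set \<Rightarrow> ('a, 'm set) module" where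
  "quotient_module M N =
     \<lparr>carrier = a_rcosets\<^bsub>M\<^esub> N,
      monoid.mult = undefined,
      monoid.one = undefined,
      ring.zero = N,
      ring.add = set_add M,
      module.smult = (\<lambda>a C. \<Union>x\<in>C. N +>\<^bsub>M\<^esub> (a \<odot>\<^bsub>M\<^esub> x))\<rparr>"

definition simple_module ::
  "('a, 'b) ring_scheme \<Rightarrow> ('a, 'm, 'c) module_scheme \<Rightarrow> bool" where
  "simple_module R S \<longleftrightarrow>
     left_module R S \<and> carrier S \<noteq> {\<zero>\<^bsub>S\<^esub>} \<and>
     (\<forall>N. Module.submodule N R S \<longrightarrow> N = {\<zero>\<^bsub>S\<^esub>} \<or> N = carrier S)"

definition maximal_submodule ::
  "('a, 'b) ring_scheme \<Rightarrow> ('a, 'm, 'c) module_scheme \<Rightarrow> 'm set \<Rightarrow> bool" where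
  "maximal_submodule R M N \<longleftrightarrow>
     Module.submodule N R M \<and> N \<noteq> carrier M \<and>
     (\<forall>N'. Module.submodule N' R M \<longrightarrow> N \<subseteq> N' \<longrightarrow> N' = N \<or> N' = carrier M)"

definition module_radical ::
  "('a, 'b) ring_scheme \<Rightarrow> ('a, 'm, 'c) module_scheme \<Rightarrow> 'm set" where
  "module_radical R M = carrier M \<inter> \<Inter> {N. maximal_submodule R M N}"

definition local_module ::
  "('a, 'b) ring_scheme \<Rightarrow> ('a, 'm, 'c) module_scheme \<Rightarrow> bool" where
  "local_module R M \<longleftrightarrow>
     left_module R M \<and> simple_module R (quotient_module M (module_radical R M))"


section \<open>The free algebra on three generators\<close>

datatype gen = GX | GY | GZ

datatype gen_word = Word (letters: "gen list")

text \<open>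
  The product on \<open>Poly_Mapping\<close> is convolution with respect to the additive monoid of
  exponents. Taking for it the words with concatenation, written additively, yields the monoid
  algebra of the free monoid, i.e. the free algebra.
\<close>

instantiation gen_word :: monoid_add
begin

definition zero_gen_word :: gen_word where
  "0 = Word []"

definition plus_gen_word :: "gen_word \<Rightarrow> gen_word \<Rightarrow> gen_word" where
  "u + v = Word (letters u @ letters v)"

instance
  by standard (simp_all add: zero_gen_word_def plus_gen_word_def)

end

type_synonym 'k free_alg = "gen_word \<Rightarrow>\<^sub>0 'k"

definition gen_mon :: "gen \<Rightarrow> 'k::field free_alg" where
  "gen_mon g = Poly_Mapping.single (Word [g]) 1"

definition free_const :: "'k::field \<Rightarrow> 'k free_alg" where
  "free_const a = Poly_Mapping.single 0 a"


section \<open>The algebra \<open>\<Lambda>(q)\<close>\<close>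

definition lambda_relations :: "'k::field \<Rightarrow> 'k free_alg set" where
  "lambda_relations q =
     (let x = gen_mon GX; y = gen_mon GY; z = gen_mon GZ in
      {x^2, y^2, z^2, y * z, x * y + free_const q * y * x, x * z - z * x, z * y - z * x})"

definition lambda_ideal :: "'k::field \<Rightarrow> 'k free_alg set" where
  "lambda_ideal q = Idl\<^bsub>ring_of_type_algebra\<^esub> (lambda_relations q)"

definition lambda_alg :: "'k::field \<Rightarrow> 'k free_alg set ring" where
  "lambda_alg q = ring_of_type_algebra Quot lambda_ideal q"

text \<open>The structure map \<open>k \<rightarrow> \<Lambda>(q)\<close>.\<close>

definition lambda_scalar :: "'k::field \<Rightarrow> 'k \<Rightarrow> 'k free_alg set" where
  "lambda_scalar q a = lambda_ideal q +>\<^bsub>ring_of_type_algebra\<^esub> free_const a"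

lemma ring_ring_of_type_algebra: "ring (ring_of_type_algebra :: 'a::ring_1 ring)"
proof -
  have "\<exists>y. x + y = 0" for x :: 'a
    using add.right_inverse by blast
  thus ?thesis
    unfolding ring_of_type_algebra_def using add.right_inverse
    by unfold_locales (auto simp:algebra_simps Units_def)
qed

lemma ideal_lambda_ideal: "ideal (lambda_ideal q) (ring_of_type_algebra :: 'k::field free_alg ring)"
  unfolding lambda_ideal_def
  by (rule ring.genideal_ideal[OF ring_ring_of_type_algebra]) (simp add: ring_of_type_algebra_def)

lemma ring_lambda_alg: "ring (lambda_alg q)"
  unfolding lambda_alg_def by (rule ideal.quotient_is_ring[OF ideal_lambda_ideal])

lemma lambda_scalar_hom: "lambda_scalar q \<in> ring_hom (ring_of_type_algebra :: 'k::field ring) (lambda_alg q)"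
proof -
  let ?F = "ring_of_type_algebra :: 'k::field free_alg ring"
  have 1: "(+>\<^bsub>?F\<^esub>) (lambda_ideal q) \<in> ring_hom ?F (lambda_alg q)"
    unfolding lambda_alg_def by (rule ideal.rcos_ring_hom[OF ideal_lambda_ideal])
  have 2: "free_const \<in> ring_hom (ring_of_type_algebra :: 'k::field ring) ?F"
    by (rule ring_hom_memI) (auto simp: ring_of_type_algebra_def free_const_def mult_single single_add single_one)
  show ?thesis
    using ring_hom_trans[OF 2 1] by (simp add: comp_def lambda_scalar_def[abs_def])
qed

definition underlying_space ::
  "'k::field \<Rightarrow> ('k free_alg set, 'm, 'c) module_scheme \<Rightarrow> ('k, 'm) module" where
  "underlying_space q M =
     \<lparr>carrier = carrier M,
      monoid.mult = undefined,
      monoid.one = undefined,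
      ring.zero = \<zero>\<^bsub>M\<^esub>,
      ring.add = add M,
      module.smult = (\<lambda>a m. lambda_scalar q a \<odot>\<^bsub>M\<^esub> m)\<rparr>"

lemma vectorspace_underlying_space:
  assumes "left_module (lambda_alg q) (M :: ('k::field free_alg set, 'm) module)"
  shows "vectorspace (ring_of_type_algebra :: 'k ring) (underlying_space q M)"
proof -
  interpret left_module "lambda_alg q" M by fact
  note h = ring_hom_closed[OF lambda_scalar_hom] ring_hom_mult[OF lambda_scalar_hom]
    ring_hom_add[OF lambda_scalar_hom] ring_hom_one[OF lambda_scalar_hom]
  interpret K: field "ring_of_type_algebra :: 'k ring" by (rule field_from_type_algebra)
  have ag: "abelian_group (underlying_space q M)"
    by (rule abelian_groupI) (auto simp: underlying_space_def M.a_ac intro: M.l_neg)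
  have "Module.module (ring_of_type_algebra :: 'k ring) (underlying_space q M)"
    by (rule moduleI[OF K.is_cring ag])
      (auto simp: underlying_space_def h smult_closed smult_l_distr smult_r_distr smult_assoc smult_one)
  then show ?thesis by (simp add: vectorspace_def K.field_axioms)
qed

definition has_dimension ::
  "'k::field \<Rightarrow> ('k free_alg set, 'm, 'c) module_scheme \<Rightarrow> nat \<Rightarrow> bool" where
  "has_dimension q M n \<longleftrightarrow>
     vectorspace.fin_dim ring_of_type_algebra (underlying_space q M) \<and>
     vectorspace.dim ring_of_type_algebra (underlying_space q M) = n"

end

theory Submission
  imports Defs "HOL-Analysis.Cartesian_Space"
begin

text \<open>
  Let \<open>J\<close> be the radical of \<open>\<Lambda>\<close>, spanned by \<open>x, y, z, yx, zx\<close>. Its square is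
  spanned by \<open>yx\<close> and \<open>zx\<close>, its cube is zero, and \<open>J\<^sup>2\<close> is the left socle. A
  torsionless module \<open>M\<close> embeds into a free module \<open>F\<close>, because a projective module is a
  summand of a free one (\<open>torsionless_embeds_in_free\<close>).

  If some element of \<open>M\<close> had a component in \<open>F\<close> outside \<open>J\<close>, it would generate a
  submodule of dimension greater than three. Hence \<open>M \<subseteq> J F\<close> (\<open>\<Phi>_B1\<close>), so
  \<open>J M\<close> lies in the socle \<open>M \<inter> J\<^sup>2 F\<close> of \<open>M\<close>. As \<open>M\<close> is
  indecomposable of dimension three, no simple submodule splits off, and the socle equals
  \<open>J M\<close> (\<open>soc_eq_rad\<close>).

  It remains to see that \<open>J M\<close> has codimension one. It is proper, since otherwise
  \<open>J M = J\<^sup>2 M = 0\<close>. Suppose that its dimension is at most one, say \<open>J M \<subseteq> k w\<close>.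
  Modulo \<open>J\<^sup>2 F\<close> an element of \<open>M\<close> has the form \<open>a x + b y + c z\<close> with vectors
  \<open>a, b, c\<close> of scalars, and \<open>x\<close>, \<open>y\<close>, \<open>z\<close> map it to
  \<open>-q b yx + c zx\<close>, \<open>a yx\<close> and \<open>(a + b) zx\<close>. That all of these are multiples of one
  vector \<open>w\<close> makes the classes of \<open>M\<close> modulo the socle a space of dimension at most one
  (\<open>dim_rad_ge_2\<close>), so that \<open>M\<close> has dimension at most two, a contradiction. So
  \<open>J M\<close> is a maximal submodule; by Nakayama's lemma
  (\<open>maximal_invariant_contains_rad\<close>) it lies in every other one, and it is the radical of
  \<open>M\<close>.

  The computations in \<open>\<Lambda>\<close> rest on six functionals on the free algebra, dual to the basis
  \<open>1, x, y, z, yx, zx\<close>, whose common kernel is exactly the ideal of relations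
  (\<open>lambda_ideal_iff_coord\<close>). The linear algebra takes place in \<open>k\<^sup>3\<close> and is carried
  over to \<open>M\<close> by a choice of basis (\<open>coordinates_exist\<close>).
\<close>

section \<open>Coordinates on \<open>\<Lambda>(q)\<close>\<close>

lemma free_const_simps:
  "free_const 0 = 0" "free_const 1 = 1"
  "free_const (a + b) = free_const a + free_const b"
  "free_const (a * b) = free_const a * free_const b"
  "free_const (- a) = - free_const a"
  by (simp_all add: free_const_def single_add mult_single single_uminus)


text \<open>
  Facts that are additive in \<open>f\<close> need only be checked on scalar multiples of words.
\<close>
lemma free_alg_single_induct [case_names single add]:
  fixes f :: "'k::field free_alg"
  assumes single: "\<And>u a. P (Poly_Mapping.single (Word u) a)"
    and add: "\<And>f g. P f \<Longrightarrow> P g \<Longrightarrow> P (f + g)"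
  shows "P f"
proof (induction f rule: update_induct)
  case const
  show ?case using single[of "[]" 0] by simp
next
  case (update f w b)
  have "Poly_Mapping.update w b f = f + Poly_Mapping.single w b"
    using update.hyps(1)
    by (intro poly_mapping_eqI) (auto simp: lookup_update lookup_add lookup_single in_keys_iff when_def)
  with add[OF update.IH single[of "letters w" b]] show ?case by simp
qed

text \<open>
  The free algebra is generated by the scalars and the three generators. This form of the
  principle suits statements about left modules, which are built up by acting with one generator
  after the other.
\<close>
lemma free_alg_induct [case_names const gen add]:
  fixes f :: "'k::field free_alg"
  assumes const: "\<And>a. P (free_const a)"
    and gen: "\<And>g f. P f \<Longrightarrow> P (gen_mon g * f)"
    and add: "\<And>f g. P f \<Longrightarrow> P g \<Longrightarrow> P (f + g)"
  shows "P f"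
proof (induction f rule: free_alg_single_induct)
  case (single u a)
  show ?case
  proof (induction u)
    case Nil
    then show ?case using const[of a] by (simp add: free_const_def zero_gen_word_def)
  next
    case (Cons g u)
    have "Poly_Mapping.single (Word (g # u)) a = gen_mon g * Poly_Mapping.single (Word u) a"
      by (simp add: gen_mon_def mult_single plus_gen_word_def)
    with gen[OF Cons] show ?case by simp
  qed
qed (rule add)

abbreviation coeff :: "'k::field free_alg \<Rightarrow> gen list \<Rightarrow> 'k" where
  "coeff f u \<equiv> Poly_Mapping.lookup f (Word u)"

lemma coeff_const: "coeff (free_const a) u = (if u = [] then a else 0)"
  by (simp add: free_const_def lookup_single zero_gen_word_def when_def)

lemma coeff_gen: "coeff (gen_mon g) u = (if u = [g] then 1 else 0)"
  by (simp add: gen_mon_def lookup_single when_def)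


lemma free_const_commute: "f * free_const a = free_const a * f"
proof (induction f rule: free_alg_single_induct)
  case (single u b)
  then show ?case
    by (simp add: free_const_def mult_single mult.commute)
qed (simp add: algebra_simps)

lemma coeff_single: "coeff (Poly_Mapping.single (Word u) a) v = (if u = v then a else 0)"
  by (simp add: lookup_single when_def)

text \<open>
  Only words of length at most two matter for \<open>\<Lambda>\<close>, because its radical has cube zero, so
  the convolution product is needed only in degrees \<open>0\<close>, \<open>1\<close> and \<open>2\<close>.
\<close>
lemma coeff_mult:
  fixes f g :: "'k::field free_alg"
  shows "coeff (f * g) [] = coeff f [] * coeff g []"
    and "coeff (f * g) [a] = coeff f [] * coeff g [a] + coeff f [a] * coeff g []"
    and "coeff (f * g) [a, b] =
      coeff f [] * coeff g [a, b] + coeff f [a] * coeff g [b] + coeff f [a, b] * coeff g []"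
proof -
  have "coeff (f * g) [] = coeff f [] * coeff g [] \<and>
    coeff (f * g) [a] = coeff f [] * coeff g [a] + coeff f [a] * coeff g [] \<and>
    coeff (f * g) [a, b] =
      coeff f [] * coeff g [a, b] + coeff f [a] * coeff g [b] + coeff f [a, b] * coeff g []"
  proof (induction f rule: free_alg_single_induct)
    case (single u c)
    show ?case
    proof (induction g rule: free_alg_single_induct)
      case (single v d)
      show ?case
        by (auto simp: mult_single plus_gen_word_def coeff_single append_eq_Cons_conv)
    qed (simp add: lookup_add distrib_left distrib_right)
  qed (simp add: lookup_add distrib_left distrib_right)
  then show "coeff (f * g) [] = coeff f [] * coeff g []"
    and "coeff (f * g) [a] = coeff f [] * coeff g [a] + coeff f [a] * coeff g []"
    and "coeff (f * g) [a, b] =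
      coeff f [] * coeff g [a, b] + coeff f [a] * coeff g [b] + coeff f [a, b] * coeff g []"
    by blast+
qed

text \<open>
  Names for the basis \<open>1, x, y, z, yx, zx\<close> of \<open>\<Lambda>\<close>.
\<close>
datatype pbw = B1 | BX | BY | BZ | BYX | BZX

text \<open>
  The coordinate functionals of \<open>\<Lambda>\<close>, lifted to the free algebra. In degree two they record
  \<open>xy = -q yx\<close> and \<open>xz = zy = zx\<close>; the words \<open>xx\<close>, \<open>yy\<close>, \<open>zz\<close>, \<open>yz\<close> and
  all longer words have coordinates zero.
\<close>
primrec coord :: "'k::field \<Rightarrow> 'k free_alg \<Rightarrow> pbw \<Rightarrow> 'k" where
  "coord q f B1 = coeff f []"
| "coord q f BX = coeff f [GX]"
| "coord q f BY = coeff f [GY]"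
| "coord q f BZ = coeff f [GZ]"
| "coord q f BYX = coeff f [GY, GX] - q * coeff f [GX, GY]"
| "coord q f BZX = coeff f [GZ, GX] + coeff f [GX, GZ] + coeff f [GZ, GY]"

lemma coord_add: "coord q (f + g) b = coord q f b + coord q g b"
  by (cases b) (simp_all add: lookup_add algebra_simps)

lemma coord_uminus: "coord q (- f) b = - coord q f b"
  by (cases b) (simp_all add: algebra_simps)

lemma coord_diff: "coord q (f - g) b = coord q f b - coord q g b"
  by (cases b) (simp_all add: lookup_minus algebra_simps)

text \<open>
  The coordinates of a product depend only on the coordinates of the factors: these formulas are
  the multiplication table of \<open>\<Lambda>\<close>. Therefore the common kernel of the coordinates is a
  two-sided ideal.
\<close>
lemma coord_mult:
  "coord q (f * g) B1 = coord q f B1 * coord q g B1"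
  "coord q (f * g) BX = coord q f B1 * coord q g BX + coord q f BX * coord q g B1"
  "coord q (f * g) BY = coord q f B1 * coord q g BY + coord q f BY * coord q g B1"
  "coord q (f * g) BZ = coord q f B1 * coord q g BZ + coord q f BZ * coord q g B1"
  "coord q (f * g) BYX = coord q f B1 * coord q g BYX + coord q f BY * coord q g BX
     - q * coord q f BX * coord q g BY + coord q f BYX * coord q g B1"
  "coord q (f * g) BZX = coord q f B1 * coord q g BZX + coord q f BZ * coord q g BX
     + coord q f BX * coord q g BZ + coord q f BZ * coord q g BY + coord q f BZX * coord q g B1"
  by (simp_all add: coeff_mult algebra_simps)

lemma coord_const: "coord q (free_const a) b = (if b = B1 then a else 0)"
  by (cases b) (simp_all add: coeff_const)

lemma coord_gen:
  "coord q (gen_mon GX) b = (if b = BX then 1 else 0)"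
  "coord q (gen_mon GY) b = (if b = BY then 1 else 0)"
  "coord q (gen_mon GZ) b = (if b = BZ then 1 else 0)"
  by (cases b; simp add: coeff_gen)+

lemma coord_const_mult: "coord q (free_const a * f) b = a * coord q f b"
  by (cases b) (simp_all only: coord_mult coord_const, simp_all)

lemma coord_0: "coord q 0 b = 0"
  by (cases b) simp_all

text \<open>
  The relations have coordinates zero and the common kernel of the coordinates is an ideal. This
  is the linear independence of the six basis elements in \<open>\<Lambda>\<close>.
\<close>
lemma coord_ideal:
  fixes f :: "'k::field free_alg"
  assumes "f \<in> lambda_ideal q"
  shows "coord q f b = 0"
proof -
  let ?F = "ring_of_type_algebra :: 'k free_alg ring"
  let ?K = "{f. \<forall>b. coord q f b = 0}"
  have F: "carrier ?F = UNIV" "ring.add ?F = (+)" "monoid.mult ?F = (*)" "ring.zero ?F = 0" "monoid.one ?F = 1"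
    by (simp_all add: ring_of_type_algebra_def fun_eq_iff)
  interpret F: ring ?F by (rule ring_ring_of_type_algebra)
  have inv: "a_inv ?F g = - g" for g
    by (rule F.minus_equality) (simp_all add: F)
  have mult: "coord q (g * h) c = 0" if "g \<in> ?K \<or> h \<in> ?K" for g h c
    using that by (cases c) (auto simp only: coord_mult, auto)
  have "ideal ?K ?F"
  proof (rule idealI)
    show "subgroup ?K (add_monoid ?F)"
    proof (rule subgroup.intro)
      show "inv\<^bsub>add_monoid ?F\<^esub> g \<in> ?K" if "g \<in> ?K" for g
        using that inv[of g, unfolded a_inv_def] by (simp only: mem_Collect_eq coord_uminus) simp
    qed (auto simp: F coord_add coord_0)
  qed (auto simp: F F.ring_axioms intro: mult)
  moreover have "lambda_relations q \<subseteq> ?K"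
  proof -
    have "coord q r c = 0" if "r \<in> lambda_relations q" for r c
      using that unfolding lambda_relations_def Let_def power2_eq_square
      by (cases c) (auto simp only: coord_mult coord_add coord_diff coord_gen coord_const insert_iff empty_iff, auto)
    then show ?thesis by auto
  qed
  ultimately have "lambda_ideal q \<subseteq> ?K"
    unfolding lambda_ideal_def by (rule F.genideal_minimal)
  with assms show ?thesis by auto
qed

lemma lambda_ideal_closed:
  fixes f g :: "'k::field free_alg"
  shows lambda_ideal_add: "\<lbrakk>f \<in> lambda_ideal q; g \<in> lambda_ideal q\<rbrakk> \<Longrightarrow> f + g \<in> lambda_ideal q"
    and lambda_ideal_diff: "\<lbrakk>f \<in> lambda_ideal q; g \<in> lambda_ideal q\<rbrakk> \<Longrightarrow> f - g \<in> lambda_ideal q"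
    and lambda_ideal_mult_left: "g \<in> lambda_ideal q \<Longrightarrow> f * g \<in> lambda_ideal q"
    and lambda_ideal_mult_right: "f \<in> lambda_ideal q \<Longrightarrow> f * g \<in> lambda_ideal q"
    and lambda_ideal_zero: "0 \<in> lambda_ideal q"
    and lambda_ideal_relation: "f \<in> lambda_relations q \<Longrightarrow> f \<in> lambda_ideal q"
proof -
  let ?F = "ring_of_type_algebra :: 'k free_alg ring"
  have F: "carrier ?F = UNIV" "ring.add ?F = (+)" "monoid.mult ?F = (*)" "ring.zero ?F = 0" "monoid.one ?F = 1"
    by (simp_all add: ring_of_type_algebra_def fun_eq_iff)
  interpret ideal "lambda_ideal q" ?F by (rule ideal_lambda_ideal)
  show add: "f + g \<in> lambda_ideal q" if "f \<in> lambda_ideal q" "g \<in> lambda_ideal q" for f g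
    using additive_subgroup.a_closed[OF is_additive_subgroup that] by (simp add: F)
  show left: "f * g \<in> lambda_ideal q" if "g \<in> lambda_ideal q" for f g
    using I_l_closed[OF that, of f] by (simp add: F)
  show "f * g \<in> lambda_ideal q" if "f \<in> lambda_ideal q"
    using I_r_closed[OF that, of g] by (simp add: F)
  show "f - g \<in> lambda_ideal q" if "f \<in> lambda_ideal q" "g \<in> lambda_ideal q"
    using add[OF that(1) left[OF that(2), of "- 1"]] by simp
  show "0 \<in> lambda_ideal q" using additive_subgroup.zero_closed[OF is_additive_subgroup] by (simp add: F)
  show "f \<in> lambda_ideal q" if "f \<in> lambda_relations q"
    using genideal_self[of "lambda_relations q"] that by (auto simp: F lambda_ideal_def)
qed

text \<open>
  The representative of a residue class in the span of the six basis words.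
\<close>
definition normal_form :: "'k::field \<Rightarrow> 'k free_alg \<Rightarrow> 'k free_alg" where
  "normal_form q f =
     free_const (coord q f B1)
     + free_const (coord q f BX) * gen_mon GX
     + free_const (coord q f BY) * gen_mon GY
     + free_const (coord q f BZ) * gen_mon GZ
     + free_const (coord q f BYX) * (gen_mon GY * gen_mon GX)
     + free_const (coord q f BZX) * (gen_mon GZ * gen_mon GX)"

text \<open>
  The six basis elements span \<open>\<Lambda>\<close>: multiplying a combination of basis words from the left
  by a generator gives, modulo the relations, a combination of basis words again. The products of
  a generator with \<open>yx\<close> or \<open>zx\<close> vanish, as each can be rewritten so that a square or
  \<open>yz\<close> occurs.
\<close>
lemma minus_normal_form_in_ideal:
  fixes f :: "'k::field free_alg"
  shows "f - normal_form q f \<in> lambda_ideal q"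
proof (induction f rule: free_alg_induct)
  case (const a)
  have "normal_form q (free_const a) = free_const a"
    by (simp add: normal_form_def coord_const free_const_simps del: coord.simps)
  then show ?case by (simp add: lambda_ideal_zero)
next
  case (add f g)
  have "f + g - normal_form q (f + g) = (f - normal_form q f) + (g - normal_form q g)"
    by (simp add: normal_form_def coord_add free_const_simps algebra_simps del: coord.simps)
  then show ?case using lambda_ideal_add[OF add] by (simp only:)
next
  case (gen g f)
  let ?I = "lambda_ideal q"
  define x y z :: "'k free_alg" where "x = gen_mon GX" and "y = gen_mon GY" and "z = gen_mon GZ"
  define k where "k b = free_const (coord q f b)" for b
  define r where "r = free_const q"
  have k: "u * k b = k b * u" for u b unfolding k_def by (rule free_const_commute)
  have k': "u * (k b * v) = k b * (u * v)" for u v b using k by (metis mult.assoc)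
  note rel = lambda_ideal_relation[of _ q, unfolded lambda_relations_def Let_def power2_eq_square,
      folded x_def y_def z_def r_def]
  have xx: "x * x \<in> ?I" and yy: "y * y \<in> ?I" and zz: "z * z \<in> ?I" and yz: "y * z \<in> ?I"
    and xy: "x * y + r * y * x \<in> ?I" and xz: "x * z - z * x \<in> ?I" and zy: "z * y - z * x \<in> ?I"
    by (rule rel; simp)+
  have xyx: "x * (y * x) \<in> ?I"
  proof -
    have "x * (y * x) = (x * y + r * y * x) * x - r * y * (x * x)"
      by (simp add: algebra_simps)
    also have "\<dots> \<in> ?I"
      by (rule lambda_ideal_diff[OF lambda_ideal_mult_right[OF xy] lambda_ideal_mult_left[OF xx]])
    finally show ?thesis .
  qed
  have xzx: "x * (z * x) \<in> ?I"
  proof -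
    have "x * (z * x) = (x * z - z * x) * x + z * (x * x)"
      by (simp add: algebra_simps)
    also have "\<dots> \<in> ?I"
      by (rule lambda_ideal_add[OF lambda_ideal_mult_right[OF xz] lambda_ideal_mult_left[OF xx]])
    finally show ?thesis .
  qed
  have yyx: "y * (y * x) \<in> ?I"
    using lambda_ideal_mult_right[OF yy, of x] by (simp add: mult.assoc)
  have yzx: "y * (z * x) \<in> ?I"
    using lambda_ideal_mult_right[OF yz, of x] by (simp add: mult.assoc)
  have zyx: "z * (y * x) \<in> ?I"
  proof -
    have "z * (y * x) = (z * y - z * x) * x + z * (x * x)"
      by (simp add: algebra_simps)
    also have "\<dots> \<in> ?I"
      by (rule lambda_ideal_add[OF lambda_ideal_mult_right[OF zy] lambda_ideal_mult_left[OF xx]])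
    finally show ?thesis .
  qed
  have zzx: "z * (z * x) \<in> ?I"
    using lambda_ideal_mult_right[OF zz, of x] by (simp add: mult.assoc)
  have nf: "normal_form q f = k B1 + k BX * x + k BY * y + k BZ * z
      + k BYX * (y * x) + k BZX * (z * x)"
    by (simp add: normal_form_def k_def x_def y_def z_def)
  have "gen_mon g * normal_form q f - normal_form q (gen_mon g * f) \<in> ?I"
  proof (cases g)
    case GX
    have "normal_form q (x * f) = k B1 * x - r * k BY * (y * x) + k BZ * (z * x)"
      by (simp only: normal_form_def coord_mult, simp only: x_def coord_gen)
        (simp add: k_def r_def y_def z_def free_const_simps del: coord.simps)
    then have "x * normal_form q f - normal_form q (x * f) =
        k BX * (x * x) + k BY * (x * y + r * y * x) + k BZ * (x * z - z * x)
        + k BYX * (x * (y * x)) + k BZX * (x * (z * x))"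
      by (simp add: nf algebra_simps k[of x] k'[of x] k[of r] k'[of r])
    also have "\<dots> \<in> ?I"
      by (intro xx xy xz xyx xzx lambda_ideal_add lambda_ideal_mult_left)
    finally show ?thesis by (simp add: GX x_def)
  next
    case GY
    have "normal_form q (y * f) = k B1 * y + k BX * (y * x)"
      by (simp only: normal_form_def coord_mult, simp only: y_def coord_gen)
        (simp add: k_def r_def x_def z_def free_const_simps del: coord.simps)
    then have "y * normal_form q f - normal_form q (y * f) =
        k BY * (y * y) + k BZ * (y * z) + k BYX * (y * (y * x)) + k BZX * (y * (z * x))"
      by (simp add: nf algebra_simps k[of y] k'[of y])
    also have "\<dots> \<in> ?I"
      by (intro yy yz yyx yzx lambda_ideal_add lambda_ideal_mult_left)
    finally show ?thesis by (simp add: GY y_def)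
  next
    case GZ
    have "normal_form q (z * f) = k B1 * z + (k BX + k BY) * (z * x)"
      by (simp only: normal_form_def coord_mult, simp only: z_def coord_gen)
        (simp add: k_def r_def x_def y_def free_const_simps del: coord.simps)
    then have "z * normal_form q f - normal_form q (z * f) =
        k BY * (z * y - z * x) + k BZ * (z * z) + k BYX * (z * (y * x)) + k BZX * (z * (z * x))"
      by (simp add: nf algebra_simps k[of z] k'[of z])
    also have "\<dots> \<in> ?I"
      by (intro zy zz zyx zzx lambda_ideal_add lambda_ideal_mult_left)
    finally show ?thesis by (simp add: GZ z_def)
  qed
  from lambda_ideal_add[OF lambda_ideal_mult_left[OF gen, of "gen_mon g"] this] show ?case
    by (simp add: algebra_simps)
qed

lemma lambda_ideal_iff_coord: "f \<in> lambda_ideal q \<longleftrightarrow> (\<forall>b. coord q f b = 0)"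
proof
  assume "\<forall>b. coord q f b = 0"
  then have "normal_form q f = 0"
    by (simp add: normal_form_def free_const_simps del: coord.simps)
  with minus_normal_form_in_ideal[of f q] show "f \<in> lambda_ideal q" by simp
qed (simp add: coord_ideal)

definition lambda_class :: "'k::field \<Rightarrow> 'k free_alg \<Rightarrow> 'k free_alg set" where
  "lambda_class q f = lambda_ideal q +>\<^bsub>ring_of_type_algebra\<^esub> f"

definition lambda_coord :: "'k::field \<Rightarrow> 'k free_alg set \<Rightarrow> pbw \<Rightarrow> 'k" where
  "lambda_coord q C = coord q (SOME f. C = lambda_class q f)"

lemma carrier_lambda_alg: "carrier (lambda_alg q) = range (lambda_class q)"
  by (auto simp: lambda_alg_def FactRing_def A_RCOSETS_def' lambda_class_def ring_of_type_algebra_def)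

lemma lambda_class_ring_hom:
  "lambda_class q \<in> ring_hom ring_of_type_algebra (lambda_alg q)"
  using ideal.rcos_ring_hom[OF ideal_lambda_ideal, of q]
  by (simp add: lambda_alg_def lambda_class_def[abs_def])

lemma lambda_class_simps:
  fixes f g :: "'k::field free_alg"
  shows lambda_class_carrier: "lambda_class q f \<in> carrier (lambda_alg q)"
    and lambda_class_add: "lambda_class q f \<oplus>\<^bsub>lambda_alg q\<^esub> lambda_class q g = lambda_class q (f + g)"
    and lambda_class_mult: "lambda_class q f \<otimes>\<^bsub>lambda_alg q\<^esub> lambda_class q g = lambda_class q (f * g)"
  using ring_hom_closed[OF lambda_class_ring_hom[of q], of f]
    ring_hom_add[OF lambda_class_ring_hom[of q], of f g]
    ring_hom_mult[OF lambda_class_ring_hom[of q], of f g]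
  by (simp_all add: ring_of_type_algebra_def)

lemma lambda_scalar_class: "lambda_scalar q a = lambda_class q (free_const a)"
  by (simp add: lambda_scalar_def lambda_class_def)

lemma lambda_class_eq_iff:
  fixes f g :: "'k::field free_alg"
  shows "lambda_class q f = lambda_class q g \<longleftrightarrow> (\<forall>b. coord q f b = coord q g b)"
proof -
  let ?F = "ring_of_type_algebra :: 'k free_alg ring"
  have F: "carrier ?F = UNIV" "ring.add ?F = (+)" "monoid.mult ?F = (*)"
    by (simp_all add: ring_of_type_algebra_def fun_eq_iff)
  interpret ideal "lambda_ideal q" ?F by (rule ideal_lambda_ideal)
  have "lambda_class q f = lambda_class q g \<longleftrightarrow> f \<ominus>\<^bsub>?F\<^esub> g \<in> lambda_ideal q"
    unfolding lambda_class_def using quotient_eq_iff_same_a_r_cos[OF ideal_axioms, of f g] by (simp add: F)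
  also have "f \<ominus>\<^bsub>?F\<^esub> g = f - g"
  proof -
    have "\<ominus>\<^bsub>?F\<^esub> g = - g"
      by (rule minus_equality) (simp_all add: ring_of_type_algebra_def)
    then show ?thesis by (simp add: a_minus_def F)
  qed
  finally show ?thesis
    by (simp add: lambda_ideal_iff_coord coord_diff del: coord.simps)
qed

text \<open>
  Coordinates do not depend on the choice of a representative.
\<close>
lemma lambda_coord_class: "lambda_coord q (lambda_class q f) b = coord q f b"
proof -
  have "lambda_class q f = lambda_class q (SOME g. lambda_class q f = lambda_class q g)"
    by (rule someI) (rule refl)
  then have "coord q f b = coord q (SOME g. lambda_class q f = lambda_class q g) b"
    unfolding lambda_class_eq_iff by blast
  then show ?thesis by (simp only: lambda_coord_def)
qed

section \<open>Three-dimensional modules in coordinates\<close>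

text \<open>
  A three-dimensional left \<open>\<Lambda>\<close>-module in coordinates, together with an embedding into a free
  module. The operators are the actions of \<open>x\<close>, \<open>y\<close> and \<open>z\<close>. Each component
  \<open>M \<rightarrow> \<Lambda>\<close> of the embedding contributes to \<open>\<Phi>\<close> its six coordinate
  functionals, indexed by the basis of \<open>\<Lambda>\<close>. Linearity of the component over
  \<open>\<Lambda>\<close> means that the operators transform these functionals by the multiplication table,
  and injectivity of the embedding means that the functionals separate points.
\<close>
locale lambda_operators =
  fixes q :: "'k::field"
    and Lx Ly Lz :: "'k^3 \<Rightarrow> 'k^3"
    and \<Phi> :: "(pbw \<Rightarrow> 'k^3 \<Rightarrow> 'k) set"
  assumes q_nonzero: "q \<noteq> 0"
    and Lx_linear: "Lx (u + v) = Lx u + Lx v" "Lx (c *s v) = c *s Lx v"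
    and Ly_linear: "Ly (u + v) = Ly u + Ly v" "Ly (c *s v) = c *s Ly v"
    and Lz_linear: "Lz (u + v) = Lz u + Lz v" "Lz (c *s v) = c *s Lz v"
    and \<Phi>_linear: "\<phi> \<in> \<Phi> \<Longrightarrow> \<phi> b (u + v) = \<phi> b u + \<phi> b v"
      "\<phi> \<in> \<Phi> \<Longrightarrow> \<phi> b (c *s v) = c * \<phi> b v"
    and \<Phi>_Lx: "\<phi> \<in> \<Phi> \<Longrightarrow> \<phi> b (Lx v) = (case b of BX \<Rightarrow> \<phi> B1 v | BYX \<Rightarrow> - q * \<phi> BY v | BZX \<Rightarrow> \<phi> BZ v | _ \<Rightarrow> 0)"
    and \<Phi>_Ly: "\<phi> \<in> \<Phi> \<Longrightarrow> \<phi> b (Ly v) = (case b of BY \<Rightarrow> \<phi> B1 v | BYX \<Rightarrow> \<phi> BX v | _ \<Rightarrow> 0)"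
    and \<Phi>_Lz: "\<phi> \<in> \<Phi> \<Longrightarrow> \<phi> b (Lz v) = (case b of BZ \<Rightarrow> \<phi> B1 v | BZX \<Rightarrow> \<phi> BX v + \<phi> BY v | _ \<Rightarrow> 0)"
    and \<Phi>_separating: "(\<And>\<phi> b. \<phi> \<in> \<Phi> \<Longrightarrow> \<phi> b v = 0) \<Longrightarrow> v = 0"
begin

definition invariant_subspace :: "('k^3) set \<Rightarrow> bool" where
  "invariant_subspace S \<longleftrightarrow> vec.subspace S \<and> (\<forall>v\<in>S. Lx v \<in> S \<and> Ly v \<in> S \<and> Lz v \<in> S)"

definition rad :: "('k^3) set" where
  "rad = {Lx a + Ly b + Lz c | a b c. True}"

text \<open>
  The elements whose image in the free module has no linear coordinates. Once the constant
  coordinates are known to vanish, these are the elements that \<open>x\<close>, \<open>y\<close> and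
  \<open>z\<close> annihilate, that is, the socle.
\<close>
definition soc :: "('k^3) set" where
  "soc = {v. \<forall>\<phi>\<in>\<Phi>. \<phi> BX v = 0 \<and> \<phi> BY v = 0 \<and> \<phi> BZ v = 0}"

lemma \<Phi>_0: "\<phi> \<in> \<Phi> \<Longrightarrow> \<phi> b 0 = 0"
  using \<Phi>_linear(2)[of \<phi> b 0 0] by simp

lemma operator_0: "Lx 0 = 0" "Ly 0 = 0" "Lz 0 = 0"
  using Lx_linear(2)[of 0 0] Ly_linear(2)[of 0 0] Lz_linear(2)[of 0 0] by simp_all

lemma not_in_span:
  assumes "\<phi> \<in> \<Phi>" and "\<And>s. s \<in> S \<Longrightarrow> \<phi> b s = 0" and "\<phi> b v \<noteq> 0"
  shows "v \<notin> vec.span S"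
proof
  assume "v \<in> vec.span S"
  moreover have "vec.subspace {v. \<phi> b v = 0}"
    by (rule vec.subspaceI) (simp_all add: \<Phi>_0 \<Phi>_linear assms(1))
  then have "vec.span S \<subseteq> {v. \<phi> b v = 0}"
    by (rule vec.span_minimal[rotated]) (auto simp: assms(2))
  ultimately show False using assms(3) by auto
qed

text \<open>
  The module lies in the radical of the free module. If a constant coordinate of \<open>v\<close> were
  nonzero, then \<open>v\<close>, \<open>xv\<close>, \<open>yv\<close> and \<open>zv\<close> would be linearly independent,
  as one sees from their coordinates at \<open>1\<close>, \<open>x\<close>, \<open>y\<close> and \<open>z\<close>.
\<close>
lemma \<Phi>_B1: "\<phi> B1 v = 0" if "\<phi> \<in> \<Phi>"
proof (rule ccontr)
  assume nz: "\<phi> B1 v \<noteq> 0"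
  note vals = \<Phi>_Lx[OF that] \<Phi>_Ly[OF that] \<Phi>_Lz[OF that]
  have "Lz v \<notin> vec.span {}"
    by (rule not_in_span[OF that, of _ BZ]) (simp_all add: vals nz)
  moreover have "Ly v \<notin> vec.span {Lz v}"
    by (rule not_in_span[OF that, of _ BY]) (auto simp: vals nz)
  moreover have "Lx v \<notin> vec.span {Ly v, Lz v}"
    by (rule not_in_span[OF that, of _ BX]) (auto simp: vals nz)
  moreover have "v \<notin> vec.span {Lx v, Ly v, Lz v}"
    by (rule not_in_span[OF that, of _ B1]) (auto simp: vals nz)
  ultimately have "vec.dim {v, Lx v, Ly v, Lz v} = 4"
    by (simp only: vec.dim_insert vec.dim_empty if_False)
  moreover have "vec.dim {v, Lx v, Ly v, Lz v} \<le> CARD(3)"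
    by (rule dim_subset_UNIV_cart_gen)
  ultimately show False by simp
qed

text \<open>
  The linear coordinates of \<open>v\<close> can be read off from the quadratic coordinates of
  \<open>xv\<close> and \<open>yv\<close>. The one at \<open>y\<close> appears there with the factor \<open>-q\<close>,
  which is where \<open>q \<noteq> 0\<close> enters.
\<close>
lemma soc_iff: "v \<in> soc \<longleftrightarrow> Lx v = 0 \<and> Ly v = 0 \<and> Lz v = 0"
proof
  assume v: "v \<in> soc"
  have "Lx v = 0"
    by (rule \<Phi>_separating) (use v in \<open>auto simp: soc_def \<Phi>_Lx \<Phi>_B1 split: pbw.split\<close>)
  moreover have "Ly v = 0"
    by (rule \<Phi>_separating) (use v in \<open>auto simp: soc_def \<Phi>_Ly \<Phi>_B1 split: pbw.split\<close>)
  moreover have "Lz v = 0"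
    by (rule \<Phi>_separating) (use v in \<open>auto simp: soc_def \<Phi>_Lz \<Phi>_B1 split: pbw.split\<close>)
  ultimately show "Lx v = 0 \<and> Ly v = 0 \<and> Lz v = 0" by simp
next
  assume v: "Lx v = 0 \<and> Ly v = 0 \<and> Lz v = 0"
  have "\<phi> BX v = 0 \<and> \<phi> BY v = 0 \<and> \<phi> BZ v = 0" if "\<phi> \<in> \<Phi>" for \<phi>
    using \<Phi>_Lx[OF that, of BYX v] \<Phi>_Lx[OF that, of BZX v] \<Phi>_Ly[OF that, of BYX v] v q_nonzero
    by (simp add: \<Phi>_0 that)
  then show "v \<in> soc" by (simp add: soc_def)
qed

lemma subspace_soc: "vec.subspace soc"
  by (rule vec.subspaceI) (auto simp: soc_def \<Phi>_0 \<Phi>_linear)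

lemma subspace_rad: "vec.subspace rad"
proof (rule vec.subspaceI)
  show "0 \<in> rad" unfolding rad_def using operator_0 by (auto intro!: exI[of _ 0])
next
  fix u v assume "u \<in> rad" "v \<in> rad"
  then obtain a b c a' b' c' where "u = Lx a + Ly b + Lz c" "v = Lx a' + Ly b' + Lz c'"
    unfolding rad_def by auto
  then have "u + v = Lx (a + a') + Ly (b + b') + Lz (c + c')"
    by (simp add: Lx_linear Ly_linear Lz_linear)
  then show "u + v \<in> rad" unfolding rad_def by blast
next
  fix r v assume "v \<in> rad"
  then obtain a b c where "v = Lx a + Ly b + Lz c" unfolding rad_def by auto
  then have "r *s v = Lx (r *s a) + Ly (r *s b) + Lz (r *s c)"
    by (simp add: Lx_linear Ly_linear Lz_linear vector_add_ldistrib)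
  then show "r *s v \<in> rad" unfolding rad_def by blast
qed

lemma operators_in_rad: "Lx v \<in> rad" "Ly v \<in> rad" "Lz v \<in> rad"
proof -
  have "Lx v = Lx v + Ly 0 + Lz 0" "Ly v = Lx 0 + Ly v + Lz 0" "Lz v = Lx 0 + Ly 0 + Lz v"
    by (simp_all add: operator_0)
  then show "Lx v \<in> rad" "Ly v \<in> rad" "Lz v \<in> rad" unfolding rad_def by blast+
qed

lemma rad_subset_soc: "rad \<subseteq> soc"
  by (auto simp: rad_def soc_def \<Phi>_linear \<Phi>_Lx \<Phi>_Ly \<Phi>_Lz \<Phi>_B1)

text \<open>
  The operators map everything into the radical and annihilate the socle, so submodules above the
  radical or inside the socle can be produced by linear algebra alone.
\<close>
lemma invariant_if_contains_rad:
  "\<lbrakk>vec.subspace S; rad \<subseteq> S\<rbrakk> \<Longrightarrow> invariant_subspace S"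
  using operators_in_rad by (auto simp: invariant_subspace_def)

lemma invariant_if_in_soc:
  "\<lbrakk>vec.subspace S; S \<subseteq> soc\<rbrakk> \<Longrightarrow> invariant_subspace S"
  using soc_iff vec.subspace_0 by (fastforce simp: invariant_subspace_def)

text \<open>
  An operator of rank at most one whose kernel lies in the socle forces the socle to have
  codimension at most one.
\<close>
lemma dim_le_if_kernel_in_soc:
  assumes add: "\<And>u v. T (u + v) = T u + T v" and scale: "\<And>c v. T (c *s v) = c *s T v"
    and range: "\<And>v. T v \<in> vec.span {w}" and kernel: "\<And>v. T v = 0 \<Longrightarrow> v \<in> soc"
  shows "3 \<le> vec.dim soc + 1"
proof (cases "\<forall>v. T v = 0")
  case True
  then have "soc = UNIV" using kernel by auto
  then show ?thesis by (simp only: vec_dim_card) simp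
next
  case False
  then obtain m where m: "T m \<noteq> 0" by blast
  have "v \<in> vec.span (insert m soc)" for v
  proof -
    obtain r where r: "T m = r *s w" using range[of m] by (auto simp: vec.span_singleton)
    obtain s where s: "T v = s *s w" using range[of v] by (auto simp: vec.span_singleton)
    have "r \<noteq> 0" using r m by auto
    then have "T (v + (- (s / r)) *s m) = 0"
      by (simp only: add scale r s vec.scale_scale vec.scale_left_distrib[symmetric]) simp
    then have "v + (- (s / r)) *s m \<in> soc" by (rule kernel)
    then have "v - (s / r) *s m \<in> soc" by simp
    then have "v - (s / r) *s m \<in> vec.span soc" by (rule vec.span_base)
    then show ?thesis using vec.span_breakdown_eq by blast
  qed
  then have "vec.span (insert m soc) = UNIV" by auto
  then have "vec.dim (insert m soc) = CARD(3)"
    by (metis vec.dim_span vec_dim_card)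
  moreover have "vec.dim (insert m soc) \<le> vec.dim soc + 1"
    by (simp add: vec.dim_insert)
  ultimately show ?thesis by simp
qed

context
  assumes indecomposable:
    "\<And>A B. \<lbrakk>invariant_subspace A; invariant_subspace B; A \<inter> B = {0}; \<And>v. \<exists>a\<in>A. \<exists>b\<in>B. v = a + b\<rbrakk>
       \<Longrightarrow> A = {0} \<or> B = {0}"
begin

text \<open>
  A vector \<open>n\<close> of the socle outside the radical spans a simple submodule. Every linear
  complement that contains the radical is a submodule too, so \<open>n\<close> would split off.
\<close>
lemma soc_eq_rad: "soc = rad"
proof (rule ccontr)
  assume "soc \<noteq> rad"
  then obtain n where n: "n \<in> soc" "n \<notin> rad" using rad_subset_soc by blast
  obtain C where C: "C \<subseteq> rad" "vec.independent C" "rad \<subseteq> vec.span C"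
    by (rule vec.maximal_independent_subset)
  have span_C: "vec.span C = rad"
    by (rule antisym[OF vec.span_minimal[OF C(1) subspace_rad] C(3)])
  have ind: "vec.independent (insert n C)"
    by (rule vec.independent_insertI) (simp_all only: span_C n(2) C(2) not_False_eq_True)
  \<comment> \<open>Extending a basis of the radical by \<open>n\<close> and then to the whole space gives the complement.\<close>
  obtain D where D: "insert n C \<subseteq> D" "vec.independent D" "UNIV \<subseteq> vec.span D"
    by (rule vec.maximal_independent_subset_extend[OF subset_UNIV ind])
  let ?A = "vec.span {n}" and ?B = "vec.span (D - {n})"
  have "n \<notin> C" using n(2) C(1) by blast
  then have B: "rad \<subseteq> ?B"
    
  proof -
    have "C \<subseteq> D - {n}" using D(1) \<open>n \<notin> C\<close> by blast
    from vec.span_mono[OF this] show ?thesis by (simp only: span_C)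
  qed
  have A: "?A \<subseteq> soc" by (rule vec.span_minimal[OF _ subspace_soc]) (simp add: n(1))
  have disjoint: "n \<notin> ?B" 
  proof
    assume "n \<in> ?B"
    moreover have "n \<in> D" using D(1) by blast
    ultimately have "vec.dependent D" unfolding vec.dependent_def by (intro bexI)
    with D(2) show False by (rule notE)
  qed
  have "?A = {0} \<or> ?B = {0}"
  proof (rule indecomposable)
    show "invariant_subspace ?A" by (rule invariant_if_in_soc) (simp_all add: A)
    show "invariant_subspace ?B" by (rule invariant_if_contains_rad) (simp_all add: B)
    show "?A \<inter> ?B = {0}"
    proof
      show "?A \<inter> ?B \<subseteq> {0}"
      proof
        fix v assume v: "v \<in> ?A \<inter> ?B"
        then obtain r where r: "v = r *s n" unfolding vec.span_singleton by blast
        have "r = 0"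
        proof (rule ccontr)
          assume "r \<noteq> 0"
          then have "n = inverse r *s v" using r by simp
          then show False using v disjoint vec.span_scale[of v "D - {n}" "inverse r"] by simp
        qed
        with r show "v \<in> {0}" by simp
      qed
    qed (simp add: vec.span_zero)
    fix v
    have "insert n (D - {n}) = D" using D(1) by blast
    then have "v \<in> vec.span (insert n (D - {n}))" using D(3) by (simp only:) blast
    then obtain r where "v - r *s n \<in> ?B" using vec.span_breakdown_eq by blast
    moreover have "v = r *s n + (v - r *s n)" by simp
    moreover have "r *s n \<in> ?A" by (simp add: vec.span_base vec.span_scale)
    ultimately show "\<exists>a\<in>?A. \<exists>b\<in>?B. v = a + b" by blast
  qed
  moreover have "n \<noteq> 0" using n(2) vec.subspace_0[OF subspace_rad] by blast
  then have "?A \<noteq> {0}" using vec.span_base[of n "{n}"] by auto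
  moreover have "?B \<noteq> {0}"
  proof
    assume "?B = {0}"
    then have "vec.dim ?B = 0" by (simp only: vec.dim_eq_0)
    then have "vec.dim (D - {n}) = 0" by (simp only: vec.dim_span)
    then have "vec.dim (insert n (D - {n})) \<le> 1" by (simp only: vec.dim_insert split: if_split) simp
    moreover have "insert n (D - {n}) = D" using D(1) by blast
    moreover have "vec.dim (vec.span D) = CARD(3)"
      using D(3) vec_dim_card top.extremum_unique[of "vec.span D"] by (simp only:)
    ultimately show False by (simp only: vec.dim_span) simp
  qed
  ultimately show False by blast
qed

text \<open>
  The heart of the matter. Suppose that the radical lies on a line \<open>k w\<close>. If all coordinates
  of \<open>w\<close> at \<open>yx\<close> vanish, then the identity (coordinate of \<open>yv\<close> at
  \<open>yx\<close>) = (coordinate of \<open>v\<close> at \<open>x\<close>) shows that the coordinates at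
  \<open>x\<close> are zero throughout, and the kernel of \<open>x\<close> is in the socle. Otherwise
  \<open>z\<close> acts as zero, because the elements \<open>zv\<close> have no coordinates at \<open>yx\<close>,
  and then the kernel of \<open>y\<close> is in the socle. In both cases one operator of rank at most one
  has its kernel in the socle, which therefore has dimension at least two; but the socle is the
  radical.
\<close>
lemma dim_rad_ge_2: "vec.dim rad \<ge> 2"
proof (rule ccontr)
  assume "\<not> vec.dim rad \<ge> 2"
  then have dim: "vec.dim rad \<le> 1" by simp
  obtain w where w: "rad \<subseteq> vec.span {w}"
  proof -
    obtain C where C: "C \<subseteq> rad" "vec.independent C" "rad \<subseteq> vec.span C" "card C = vec.dim rad"
      using vec.basis_exists[of rad] by blast
    have "finite C" using C(2) vec.finiteI_independent by blast
    then have "C = {} \<or> (\<exists>w. C = {w})"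
      using C(4) dim by (metis card_0_eq card_1_singletonE le_0_eq le_SucE One_nat_def)
    then obtain w where "C \<subseteq> {w}" by blast
    with C(3) that show ?thesis using vec.span_mono by blast
  qed
  have line: "\<exists>r. T = r *s w" if "T \<in> rad" for T
    using w that by (auto simp: vec.span_singleton)
  have scalar: "\<phi> b (r *s w) = r * \<phi> b w" if "\<phi> \<in> \<Phi>" for \<phi> b r
    by (rule \<Phi>_linear(2)[OF that])
  have "3 \<le> vec.dim soc + 1"
  proof (cases "\<forall>\<phi>\<in>\<Phi>. \<phi> BYX w = 0")
    case True
    show ?thesis
    proof (rule dim_le_if_kernel_in_soc[where T = Lx and w = w])
      fix v assume v: "Lx v = 0"
      have "\<phi> BX v = 0 \<and> \<phi> BY v = 0 \<and> \<phi> BZ v = 0" if "\<phi> \<in> \<Phi>" for \<phi>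
      proof -
        obtain r where "Ly v = r *s w" using line operators_in_rad by blast
        then have "\<phi> BX v = 0" using \<Phi>_Ly[OF that, of BYX v] scalar[OF that] True[rule_format, OF that] by simp
        moreover have "\<phi> BY v = 0" "\<phi> BZ v = 0"
          using \<Phi>_Lx[OF that, of BYX v] \<Phi>_Lx[OF that, of BZX v] v q_nonzero by (simp_all add: \<Phi>_0 that)
        ultimately show ?thesis by simp
      qed
      then show "v \<in> soc" by (simp add: soc_def)
    qed (use w operators_in_rad Lx_linear in auto)
  next
    case False
    then obtain \<psi> where \<psi>: "\<psi> \<in> \<Phi>" "\<psi> BYX w \<noteq> 0" by blast
    have Lz: "Lz v = 0" for v
    proof -
      obtain r where r: "Lz v = r *s w" using line operators_in_rad by blast
      then have "r * \<psi> BYX w = 0" using \<Phi>_Lz[OF \<psi>(1), of BYX v] scalar[OF \<psi>(1)] by simp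
      with r \<psi>(2) show ?thesis by simp
    qed
    show ?thesis
    proof (rule dim_le_if_kernel_in_soc[where T = Ly and w = w])
      fix v assume v: "Ly v = 0"
      have first: "\<phi> BX v = 0 \<and> \<phi> BY v = 0" if "\<phi> \<in> \<Phi>" for \<phi>
        using \<Phi>_Ly[OF that, of BYX v] \<Phi>_Lz[OF that, of BZX v] v Lz[of v] by (simp add: \<Phi>_0 that)
      have "Lx v = 0"
      proof -
        obtain r where r: "Lx v = r *s w" using line operators_in_rad by blast
        then have "r * \<psi> BYX w = 0"
          using \<Phi>_Lx[OF \<psi>(1), of BYX v] scalar[OF \<psi>(1)] first[OF \<psi>(1)] by simp
        with r \<psi>(2) show ?thesis by simp
      qed
      with v Lz show "v \<in> soc" by (simp add: soc_iff)
    qed (use w operators_in_rad Ly_linear in auto)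
  qed
  with dim show False by (simp add: soc_eq_rad)
qed

lemma rad_proper: "rad \<noteq> UNIV"
proof
  assume UNIV: "rad = UNIV"
  have "v = 0" for v :: "'k^3"
  proof -
    have "v \<in> rad" by (simp add: UNIV)
    moreover have "Lx u = 0 \<and> Ly u = 0 \<and> Lz u = 0" for u
      using soc_iff[of u] by (simp add: soc_eq_rad UNIV)
    ultimately show "v = 0" by (auto simp: rad_def)
  qed
  then have "(axis 1 1 :: 'k^3) = 0" .
  then show False by (simp add: axis_eq_0_iff)
qed

lemma rad_maximal:
  assumes "vec.subspace L" and "rad \<subseteq> L"
  shows "L = rad \<or> L = UNIV"
proof (cases "vec.dim L \<le> 2")
  case True
  then have "rad = L"
    using vec.subspace_dim_equal[OF subspace_rad assms] dim_rad_ge_2 by simp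
  then show ?thesis by simp
next
  case False
  then have "vec.dim (UNIV :: ('k^3) set) \<le> vec.dim L" by (simp only: vec_dim_card) simp
  then show ?thesis using vec.subspace_dim_equal[OF assms(1) vec.subspace_UNIV subset_UNIV] by simp
qed

end

text \<open>
  Nakayama's lemma for a module of Loewy length two: if \<open>L\<close> and the radical span everything,
  then the operators, which kill the radical, have all their values in \<open>L\<close>.
\<close>
lemma maximal_invariant_contains_rad:
  assumes L: "invariant_subspace L"
    and maximal: "\<And>S. \<lbrakk>invariant_subspace S; L \<subseteq> S\<rbrakk> \<Longrightarrow> S = L \<or> S = UNIV"
  shows "rad \<subseteq> L"
proof -
  let ?S = "{l + r | l r. l \<in> L \<and> r \<in> rad}"
  have sub: "vec.subspace L" using L by (simp add: invariant_subspace_def)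
  have left: "L \<subseteq> ?S" using vec.subspace_0[OF subspace_rad] by force
  have right: "rad \<subseteq> ?S" using vec.subspace_0[OF sub] by force
  have "invariant_subspace ?S"
    by (rule invariant_if_contains_rad[OF vec.subspace_sums[OF sub subspace_rad] right])
  then consider "?S = L" | "?S = UNIV" using maximal left by blast
  then show ?thesis
  proof cases
    case 1
    with right show ?thesis by simp
  next
    case 2
    have "Lx v \<in> L \<and> Ly v \<in> L \<and> Lz v \<in> L" for v
    proof -
      obtain l r where v: "v = l + r" "l \<in> L" "r \<in> rad" using 2 by blast
      have "Lx r = 0" "Ly r = 0" "Lz r = 0"
        using v(3) rad_subset_soc soc_iff by blast+
      then show ?thesis
        using L v(1,2) by (simp add: Lx_linear Ly_linear Lz_linear invariant_subspace_def)
    qed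
    then show ?thesis using vec.subspace_add[OF sub] by (auto simp: rad_def)
  qed
qed

end

section \<open>Quotients, radicals and torsionless modules\<close>

lemma submoduleD:
  assumes "Module.submodule N R M"
  shows "N \<subseteq> carrier M" "\<zero>\<^bsub>M\<^esub> \<in> N"
    "\<And>x y. x \<in> N \<Longrightarrow> y \<in> N \<Longrightarrow> x \<oplus>\<^bsub>M\<^esub> y \<in> N"
    "\<And>a x. a \<in> carrier R \<Longrightarrow> x \<in> N \<Longrightarrow> a \<odot>\<^bsub>M\<^esub> x \<in> N"
    "subgroup N (add_monoid M)"
  using assms subgroup.subset[of N "add_monoid M"] subgroup.one_closed[of N "add_monoid M"]
    subgroup.m_closed[of N "add_monoid M"]
  by (auto simp: Module.submodule_def Module.submodule_axioms_def)

context left_module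
begin

lemma smult_zero_left:
  assumes "x \<in> carrier M"
  shows "\<zero> \<odot>\<^bsub>M\<^esub> x = \<zero>\<^bsub>M\<^esub>"
proof -
  have c: "\<zero> \<odot>\<^bsub>M\<^esub> x \<in> carrier M" by (rule smult_closed[OF R.zero_closed assms])
  have "\<zero> \<odot>\<^bsub>M\<^esub> x \<oplus>\<^bsub>M\<^esub> \<zero> \<odot>\<^bsub>M\<^esub> x = (\<zero> \<oplus> \<zero>) \<odot>\<^bsub>M\<^esub> x"
    by (rule smult_l_distr[symmetric]) (simp_all add: assms)
  also have "\<dots> = \<zero> \<odot>\<^bsub>M\<^esub> x" by simp
  finally show ?thesis using M.add.l_cancel_one[OF c c] by simp
qed

lemma smult_minus_one:
  assumes "x \<in> carrier M"
  shows "(\<ominus> \<one>) \<odot>\<^bsub>M\<^esub> x = \<ominus>\<^bsub>M\<^esub> x"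
proof -
  have "(\<ominus> \<one>) \<odot>\<^bsub>M\<^esub> x \<oplus>\<^bsub>M\<^esub> x = (\<ominus> \<one> \<oplus> \<one>) \<odot>\<^bsub>M\<^esub> x"
    using smult_l_distr[of "\<ominus> \<one>" \<one> x] assms by (simp add: smult_one)
  also have "\<dots> = \<zero>\<^bsub>M\<^esub>" by (simp add: R.l_neg smult_zero_left assms)
  finally show ?thesis
    by (rule M.minus_equality[symmetric]) (simp_all add: assms smult_closed)
qed

text \<open>
  Closure under negatives is implied by closure under the scalar \<open>-1\<close>.
\<close>
lemma submoduleI:
  assumes "N \<subseteq> carrier M" "\<zero>\<^bsub>M\<^esub> \<in> N"
    and "\<And>x y. x \<in> N \<Longrightarrow> y \<in> N \<Longrightarrow> x \<oplus>\<^bsub>M\<^esub> y \<in> N"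
    and smult: "\<And>a x. a \<in> carrier R \<Longrightarrow> x \<in> N \<Longrightarrow> a \<odot>\<^bsub>M\<^esub> x \<in> N"
  shows "Module.submodule N R M"
proof -
  have "\<ominus>\<^bsub>M\<^esub> x \<in> N" if "x \<in> N" for x
    using smult[of "\<ominus> \<one>" x] smult_minus_one[of x] that assms(1) by auto
  then show ?thesis
    using assms by (auto simp: Module.submodule_def Module.submodule_axioms_def subgroup_def a_inv_def)
qed

lemma submodule_abelian_subgroup:
  "Module.submodule N R M \<Longrightarrow> abelian_subgroup N M"
  by (rule abelian_subgroupI2[OF M.a_comm_group submoduleD(5)])

text \<open>
  The product in the quotient is defined as a union over all representatives; this union is the
  coset of a single product since all its members agree.
\<close>
lemma quotient_smult:
  assumes "Module.submodule N R M" and a: "a \<in> carrier R" and x: "x \<in> carrier M"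
  shows "a \<odot>\<^bsub>quotient_module M N\<^esub> (N +>\<^bsub>M\<^esub> x) = N +>\<^bsub>M\<^esub> (a \<odot>\<^bsub>M\<^esub> x)"
proof -
  note N = submoduleD[OF assms(1)]
  have const: "N +>\<^bsub>M\<^esub> (a \<odot>\<^bsub>M\<^esub> y) = N +>\<^bsub>M\<^esub> (a \<odot>\<^bsub>M\<^esub> x)" if y: "y \<in> N +>\<^bsub>M\<^esub> x" for y
  proof -
    obtain n where n: "n \<in> N" "y = n \<oplus>\<^bsub>M\<^esub> x" using y by (auto simp: a_r_coset_def')
    then have "a \<odot>\<^bsub>M\<^esub> y = (a \<odot>\<^bsub>M\<^esub> n) \<oplus>\<^bsub>M\<^esub> (a \<odot>\<^bsub>M\<^esub> x)"
      using N(1) a x by (simp add: smult_r_distr subset_iff)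
    then have "a \<odot>\<^bsub>M\<^esub> y \<in> N +>\<^bsub>M\<^esub> (a \<odot>\<^bsub>M\<^esub> x)"
      using M.a_rcosI[OF N(4)[OF a n(1)] N(1) smult_closed[OF a x]] by simp
    from M.a_repr_independence[OF this smult_closed[OF a x] N(5)] show ?thesis by simp
  qed
  have "x \<in> N +>\<^bsub>M\<^esub> x"
    using M.a_rcosI[OF N(2) N(1) x] x by simp
  then have "(\<Union>y\<in>N +>\<^bsub>M\<^esub> x. N +>\<^bsub>M\<^esub> (a \<odot>\<^bsub>M\<^esub> y)) = N +>\<^bsub>M\<^esub> (a \<odot>\<^bsub>M\<^esub> x)"
    by (rule UN_constant_eq) (use const in blast)
  then show ?thesis by (simp add: quotient_module_def)
qed

lemma quotient_left_module:
  assumes "Module.submodule N R M"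
  shows "left_module R (quotient_module M N)"
proof -
  interpret N: abelian_subgroup N M by (rule submodule_abelian_subgroup[OF assms])
  let ?Q = "quotient_module M N"
  note sub = submoduleD[OF assms]
  have car: "carrier ?Q = (\<lambda>x. N +>\<^bsub>M\<^esub> x) ` carrier M"
    by (auto simp: quotient_module_def A_RCOSETS_def')
  have add: "(N +>\<^bsub>M\<^esub> x) \<oplus>\<^bsub>?Q\<^esub> (N +>\<^bsub>M\<^esub> y) = N +>\<^bsub>M\<^esub> (x \<oplus>\<^bsub>M\<^esub> y)"
    if "x \<in> carrier M" "y \<in> carrier M" for x y
    using N.a_rcos_sum[OF that] by (simp add: quotient_module_def)
  have zero: "\<zero>\<^bsub>?Q\<^esub> = N +>\<^bsub>M\<^esub> \<zero>\<^bsub>M\<^esub>"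
    using M.a_coset_add_zero[OF sub(1)] by (simp add: quotient_module_def)
  have "abelian_group ?Q"
  proof (rule abelian_groupI)
    fix C assume "C \<in> carrier ?Q"
    then obtain x where x: "x \<in> carrier M" "C = N +>\<^bsub>M\<^esub> x" unfolding car by blast
    then have "N +>\<^bsub>M\<^esub> (\<ominus>\<^bsub>M\<^esub> x) \<in> carrier ?Q" "(N +>\<^bsub>M\<^esub> (\<ominus>\<^bsub>M\<^esub> x)) \<oplus>\<^bsub>?Q\<^esub> C = \<zero>\<^bsub>?Q\<^esub>"
      by (simp_all add: car add zero M.l_neg)
    then show "\<exists>D\<in>carrier ?Q. D \<oplus>\<^bsub>?Q\<^esub> C = \<zero>\<^bsub>?Q\<^esub>" by blast
  qed (auto simp: car add zero M.a_ac)
  then show ?thesis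
    by (intro left_module.intro left_module_axioms.intro R.ring_axioms)
      (auto simp: car add quotient_smult[OF assms] smult_closed smult_l_distr smult_r_distr
        smult_assoc smult_one)
qed

text \<open>
  Submodules of the quotient pull back to submodules that contain \<open>N\<close>.
\<close>
lemma quotient_by_maximal_simple:
  assumes "maximal_submodule R M N"
  shows "simple_module R (quotient_module M N)"
proof -
  let ?Q = "quotient_module M N"
  have N: "Module.submodule N R M" and proper: "N \<noteq> carrier M"
    and max: "\<And>N'. Module.submodule N' R M \<Longrightarrow> N \<subseteq> N' \<Longrightarrow> N' = N \<or> N' = carrier M"
    using assms by (auto simp: maximal_submodule_def)
  interpret N: abelian_subgroup N M by (rule submodule_abelian_subgroup[OF N])
  note sub = submoduleD[OF N]
  have car: "carrier ?Q = (\<lambda>x. N +>\<^bsub>M\<^esub> x) ` carrier M"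
    by (auto simp: quotient_module_def A_RCOSETS_def')
  have zero: "\<zero>\<^bsub>?Q\<^esub> = N" by (simp add: quotient_module_def)
  have add: "(N +>\<^bsub>M\<^esub> x) \<oplus>\<^bsub>?Q\<^esub> (N +>\<^bsub>M\<^esub> y) = N +>\<^bsub>M\<^esub> (x \<oplus>\<^bsub>M\<^esub> y)"
    if "x \<in> carrier M" "y \<in> carrier M" for x y
    using N.a_rcos_sum[OF that] by (simp add: quotient_module_def)
  have self: "x \<in> N +>\<^bsub>M\<^esub> x" if "x \<in> carrier M" for x
    using M.a_rcosI[OF sub(2) sub(1) that] that by simp
  have in_N: "N +>\<^bsub>M\<^esub> x = N \<longleftrightarrow> x \<in> N" if "x \<in> carrier M" for x
    using self[OF that] M.a_coset_join2[OF that sub(5)] by blast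
  have "carrier ?Q \<noteq> {\<zero>\<^bsub>?Q\<^esub>}"
  proof -
    obtain x where "x \<in> carrier M" "x \<notin> N" using proper sub(1) by blast
    then have "N +>\<^bsub>M\<^esub> x \<in> carrier ?Q" "N +>\<^bsub>M\<^esub> x \<noteq> N" using in_N by (simp_all add: car)
    then show ?thesis unfolding zero by blast
  qed
  moreover have "K = {\<zero>\<^bsub>?Q\<^esub>} \<or> K = carrier ?Q" if K: "Module.submodule K R ?Q" for K
  proof -
    note subK = submoduleD[OF K]
    let ?P = "{x \<in> carrier M. N +>\<^bsub>M\<^esub> x \<in> K}"
    have P: "Module.submodule ?P R M"
    proof (rule submoduleI)
      show "\<zero>\<^bsub>M\<^esub> \<in> ?P" using in_N[of "\<zero>\<^bsub>M\<^esub>"] sub(2) subK(2) by (simp add: zero)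
      show "x \<oplus>\<^bsub>M\<^esub> y \<in> ?P" if "x \<in> ?P" "y \<in> ?P" for x y
        using that subK(3)[of "N +>\<^bsub>M\<^esub> x" "N +>\<^bsub>M\<^esub> y"] by (simp add: add)
      show "a \<odot>\<^bsub>M\<^esub> x \<in> ?P" if "a \<in> carrier R" "x \<in> ?P" for a x
        using that subK(4)[of a "N +>\<^bsub>M\<^esub> x"] by (simp add: quotient_smult[OF N] smult_closed)
    qed blast
    have "N \<subseteq> ?P"
    proof
      fix x assume x: "x \<in> N"
      then have "x \<in> carrier M" using sub(1) by blast
      with x in_N[of x] subK(2) show "x \<in> ?P" by (simp add: zero)
    qed
    from max[OF P this] consider "?P = N" | "?P = carrier M" by (rule disjE)
    then show ?thesis
    proof cases
      case 1
      have "C = N" if C: "C \<in> K" for C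
      proof -
        obtain x where x: "x \<in> carrier M" "C = N +>\<^bsub>M\<^esub> x" using C subK(1) unfolding car by blast
        with C have "x \<in> ?P" by simp
        then have "x \<in> N" by (simp only: 1)
        with x in_N[of x] show ?thesis by simp
      qed
      then show ?thesis using subK(2) unfolding zero by blast
    next
      case 2
      then have "carrier ?Q \<subseteq> K" unfolding car by blast
      then show ?thesis using subK(1) by blast
    qed
  qed
  ultimately show ?thesis
    by (simp add: simple_module_def quotient_left_module[OF N])
qed

lemma local_if_radical_maximal:
  "maximal_submodule R M (module_radical R M) \<Longrightarrow> local_module R M"
  by (simp add: local_module_def left_module_axioms quotient_by_maximal_simple)

lemma radical_eq_if_least_maximal:
  assumes "maximal_submodule R M N" and "\<And>N'. maximal_submodule R M N' \<Longrightarrow> N \<subseteq> N'"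
  shows "module_radical R M = N"
proof -
  have "N \<subseteq> carrier M" using assms(1) submoduleD(1)[of N R M] unfolding maximal_submodule_def by blast
  then show ?thesis using assms unfolding module_radical_def by blast
qed

end

text \<open>
  A projective module is a summand, and therefore a submodule, of a free module.
\<close>
lemma torsionless_embeds_in_free:
  assumes "torsionless_module TYPE('p) R M"
  obtains I :: "'p set" and h
  where "h \<in> LinearCombinations.module_hom R M (free_module R I)" "inj_on h (carrier M)"
proof -
  obtain P :: "('a, 'p) module" and N f where P: "projective_module R P" "Module.submodule N R P"
    and f: "f \<in> LinearCombinations.module_hom R M (P\<lparr>carrier := N\<rparr>)" "bij_betw f (carrier M) N"
    using assms by (auto simp: torsionless_module_def module_isomorphic_def)
  obtain I :: "'p set" and K K' g where I: "internal_direct_sum R (free_module R I) K K'"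
    and g: "g \<in> LinearCombinations.module_hom R P ((free_module R I)\<lparr>carrier := K\<rparr>)"
      "bij_betw g (carrier P) K"
    using P(1) by (auto simp: projective_module_def module_isomorphic_def)
  have N: "N \<subseteq> carrier P" by (rule submoduleD(1)[OF P(2)])
  have K: "K \<subseteq> carrier (free_module R I)"
    using I by (auto simp: internal_direct_sum_def dest: submoduleD(1))
  have "g \<circ> f \<in> LinearCombinations.module_hom R M (free_module R I)"
    using f(1) g(1) N K by (simp add: LinearCombinations.module_hom_def Pi_iff subset_iff)
  moreover have "inj_on (g \<circ> f) (carrier M)"
    using f(2) g(2) N comp_inj_on[of f "carrier M" g] inj_on_subset[of g "carrier P" N]
    by (simp add: bij_betw_def)
  ultimately show ?thesis by (rule that)
qed

section \<open>From modules to linear algebra\<close>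

text \<open>
  A basis of the underlying vector space identifies it with \<open>k\<^sup>n\<close>, where subspaces, spans
  and dimensions obey the usual rules without carrier conditions.
\<close>
lemma coordinates_exist:
  fixes M :: "('k::field free_alg set, 'm) module"
  assumes M: "left_module (lambda_alg q) M" and dim: "has_dimension q M CARD('n::finite)"
  obtains \<beta> :: "'k^'n \<Rightarrow> 'm"
  where "bij_betw \<beta> UNIV (carrier M)"
    and "\<And>u v. \<beta> (u + v) = \<beta> u \<oplus>\<^bsub>M\<^esub> \<beta> v"
    and "\<And>c v. \<beta> (c *s v) = lambda_scalar q c \<odot>\<^bsub>M\<^esub> \<beta> v"
proof -
  let ?K = "ring_of_type_algebra :: 'k ring" and ?V = "underlying_space q M"
  interpret V: vectorspace ?K ?V by (rule vectorspace_underlying_space[OF M])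
  have K: "carrier ?K = UNIV" "ring.add ?K = (+)" "monoid.mult ?K = (*)"
    by (simp_all add: ring_of_type_algebra_def fun_eq_iff)
  have V: "carrier ?V = carrier M" "ring.add ?V = ring.add M"
    "module.smult ?V = (\<lambda>a m. lambda_scalar q a \<odot>\<^bsub>M\<^esub> m)"
    by (simp_all add: underlying_space_def)
  have fin: V.fin_dim and card: "V.dim = CARD('n)" using dim by (simp_all add: has_dimension_def)
  obtain B where B: "finite B" "V.basis B" using V.finite_basis_exists[OF fin] by blast
  have B_sub: "B \<subseteq> carrier ?V" using B(2) by (simp add: V.basis_def)
  have "card B = card (UNIV :: 'n set)" using V.dim_basis[OF B] card by simp
  then obtain f :: "'m \<Rightarrow> 'n" where f: "bij_betw f B UNIV"
    using finite_same_card_bij[OF B(1) finite_class.finite_UNIV] by blast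
  define \<beta> where "\<beta> v = V.lincomb (\<lambda>m. v $ f m) B" for v :: "'k^'n"
  have unique: "\<exists>!a. a \<in> B \<rightarrow>\<^sub>E carrier ?K \<and> V.lincomb a B = m" if "m \<in> carrier M" for m
    using V.basis_criterion[OF B(1) B_sub] B(2) that by (simp add: V)
  have restrict: "V.lincomb (restrict a B) B = V.lincomb a B" for a
    by (rule V.lincomb_cong) (auto simp: B_sub[THEN subsetD] K)
  have closed: "\<beta> v \<in> carrier M" for v
    using V.lincomb_closed[OF B_sub, of "\<lambda>m. v $ f m"] by (simp add: \<beta>_def V K)
  have "inj \<beta>"
  proof (rule injI)
    fix u v assume eq: "\<beta> u = \<beta> v"
    have "restrict (\<lambda>m. u $ f m) B = restrict (\<lambda>m. v $ f m) B"
      using unique[OF closed[of u]] eq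
      by (elim ex1E) (metis (no_types, lifting) K(1) PiE_restrict UNIV_I \<beta>_def restrict restrict_PiE_iff)
    then have "u $ f m = v $ f m" if "m \<in> B" for m
      using that by (metis restrict_apply')
    then show "u = v"
      using f by (metis (no_types, lifting) UNIV_I bij_betw_imp_surj_on imageE vec_eq_iff)
  qed
  moreover have "m \<in> range \<beta>" if m: "m \<in> carrier M" for m
  proof -
    obtain a where a: "V.lincomb a B = m" using unique[OF m] by blast
    have "\<beta> (\<chi> i. a (inv_into B f i)) = V.lincomb a B"
      unfolding \<beta>_def
      by (rule V.lincomb_cong) (use f B_sub in \<open>auto simp: K bij_betw_inv_into_left\<close>)
    with a show ?thesis by (metis rangeI)
  qed
  ultimately have "bij_betw \<beta> UNIV (carrier M)"
    using closed by (auto simp: bij_betw_def)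
  moreover have "\<beta> (u + v) = \<beta> u \<oplus>\<^bsub>M\<^esub> \<beta> v" for u v
    using V.lincomb_sum[OF B(1) B_sub, of "\<lambda>m. u $ f m" "\<lambda>m. v $ f m"] by (simp add: \<beta>_def K V)
  moreover have "\<beta> (c *s v) = lambda_scalar q c \<odot>\<^bsub>M\<^esub> \<beta> v" for c v
    using V.lincomb_smult[OF B_sub, of "\<lambda>m. v $ f m" c] by (simp add: \<beta>_def K V)
  ultimately show ?thesis by (rule that)
qed


section \<open>Three-dimensional torsionless modules\<close>

theorem proposition2:
  fixes q :: "'k::field" and M :: "('k free_alg set, 'm) module"
  assumes "q \<noteq> 0"
    and "left_module (lambda_alg q) M"
    and "indecomposable_module (lambda_alg q) M"
    and "has_dimension q M 3"
    and "torsionless_module TYPE('p) (lambda_alg q) M"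
  shows "local_module (lambda_alg q) M"
proof -
  let ?L = "lambda_alg q"
  interpret M: left_module ?L M by (rule assms(2))
  have dim: "has_dimension q M CARD(3)" using assms(4) by simp
  obtain \<beta> :: "'k^3 \<Rightarrow> 'm" where bij: "bij_betw \<beta> UNIV (carrier M)"
    and \<beta>_add: "\<And>u v. \<beta> (u + v) = \<beta> u \<oplus>\<^bsub>M\<^esub> \<beta> v"
    and \<beta>_scale: "\<And>c v. \<beta> (c *s v) = lambda_scalar q c \<odot>\<^bsub>M\<^esub> \<beta> v"
    by (rule coordinates_exist[OF assms(2) dim]) (rule that)
  obtain I :: "'p set" and h
    where h: "h \<in> LinearCombinations.module_hom ?L M (free_module ?L I)" "inj_on h (carrier M)"
    using torsionless_embeds_in_free[OF assms(5)] .
  \<comment> \<open>The action of the free algebra, transported to \<open>k\<^sup>3\<close> along \<open>\<beta>\<close>.\<close>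
  define act where "act f v = inv_into UNIV \<beta> (lambda_class q f \<odot>\<^bsub>M\<^esub> \<beta> v)" for f v
  have closed: "\<beta> v \<in> carrier M" for v using bij by (auto simp: bij_betw_def)
  have inj: "\<beta> u = \<beta> v \<longleftrightarrow> u = v" for u v using bij by (auto simp: bij_betw_def inj_def)
  have surj: "\<exists>v. m = \<beta> v" if "m \<in> carrier M" for m using bij that by (auto simp: bij_betw_def)
  have \<beta>_act: "\<beta> (act f v) = lambda_class q f \<odot>\<^bsub>M\<^esub> \<beta> v" for f v
    unfolding act_def using bij M.smult_closed[OF lambda_class_carrier closed]
    by (auto intro!: f_inv_into_f simp: bij_betw_def)
  have \<beta>_0: "\<beta> 0 = \<zero>\<^bsub>M\<^esub>"
  proof -
    have "\<beta> 0 \<oplus>\<^bsub>M\<^esub> \<beta> 0 = \<beta> 0" by (simp only: \<beta>_add[symmetric] add_0)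
    then show ?thesis by (simp only: M.M.add.l_cancel_one[OF closed closed])
  qed
  have act_add: "act f (u + v) = act f u + act f v" for f u v
    by (subst inj[symmetric])
      (simp add: \<beta>_act \<beta>_add M.smult_r_distr lambda_class_carrier closed)
  have act_mult: "act (f * g) v = act f (act g v)" for f g v
    by (subst inj[symmetric])
      (simp add: \<beta>_act M.smult_assoc[symmetric] lambda_class_simps closed)
  have act_sum: "act (f + g) v = act f v + act g v" for f g v
    by (subst inj[symmetric])
      (simp add: \<beta>_act \<beta>_add M.smult_l_distr[symmetric] lambda_class_simps closed)
  have act_const: "act (free_const c) v = c *s v" for c v
    by (subst inj[symmetric]) (simp add: \<beta>_act \<beta>_scale lambda_scalar_class)
  have act_scale: "act f (c *s v) = c *s act f v" for f c v
    by (simp only: act_const[symmetric] act_mult[symmetric] free_const_commute[of f])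
  have h_closed: "h (\<beta> v) \<in> I \<rightarrow>\<^sub>E carrier ?L" for v
    using module_hom_closed[OF h(1)] closed[of v] by (auto simp: free_module_def)
  have h_class: "\<exists>f. h (\<beta> v) i = lambda_class q f" if "i \<in> I" for v i
    using h_closed[of v] that by (auto simp: carrier_lambda_alg)
  have h_add: "h (\<beta> (u + v)) i = h (\<beta> u) i \<oplus>\<^bsub>?L\<^esub> h (\<beta> v) i" if "i \<in> I" for u v i
    using module_hom_add[OF h(1) closed closed, of u v] that by (simp add: \<beta>_add free_module_def)
  have h_act: "h (\<beta> (act f v)) i = lambda_class q f \<otimes>\<^bsub>?L\<^esub> h (\<beta> v) i" if "i \<in> I" for f v i
    using module_hom_smult[OF h(1) lambda_class_carrier closed, of f v] that
    by (simp add: \<beta>_act free_module_def)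
  \<comment> \<open>The coordinate functionals of all components of the embedding \<open>h\<close>.\<close>
  define \<Phi> where "\<Phi> = (\<lambda>i b v. lambda_coord q (h (\<beta> v) i) b) ` I"
  have coord_act: "\<exists>g. \<forall>b. \<phi> b v = coord q g b \<and> (\<forall>f. \<phi> b (act f v) = coord q (f * g) b)"
    if "\<phi> \<in> \<Phi>" for \<phi> v
  proof -
    obtain i where i: "i \<in> I" "\<phi> = (\<lambda>b v. lambda_coord q (h (\<beta> v) i) b)"
      using \<open>\<phi> \<in> \<Phi>\<close> by (auto simp: \<Phi>_def)
    obtain g where g: "h (\<beta> v) i = lambda_class q g" using h_class[OF i(1)] by blast
    show ?thesis
      by (intro exI[of _ g])
        (simp add: i(2) g h_act[OF i(1)] lambda_class_mult lambda_coord_class del: coord.simps)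
  qed
  interpret lambda_operators q "act (gen_mon GX)" "act (gen_mon GY)" "act (gen_mon GZ)" \<Phi>
  proof
    fix \<phi> b u v c assume \<phi>: "\<phi> \<in> \<Phi>"
    obtain g where g: "\<And>b. \<phi> b v = coord q g b" "\<And>b f. \<phi> b (act f v) = coord q (f * g) b"
      using coord_act[OF \<phi>, of v] by blast
    show "\<phi> b (c *s v) = c * \<phi> b v"
      using g(2)[of b "free_const c"] by (simp add: act_const coord_const_mult g(1) del: coord.simps)
    show "\<phi> b (act (gen_mon GX) v) =
        (case b of BX \<Rightarrow> \<phi> B1 v | BYX \<Rightarrow> - q * \<phi> BY v | BZX \<Rightarrow> \<phi> BZ v | _ \<Rightarrow> 0)"
      unfolding g by (cases b) (simp_all only: coord_mult coord_gen, simp_all)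
    show "\<phi> b (act (gen_mon GY) v) =
        (case b of BY \<Rightarrow> \<phi> B1 v | BYX \<Rightarrow> \<phi> BX v | _ \<Rightarrow> 0)"
      unfolding g by (cases b) (simp_all only: coord_mult coord_gen, simp_all)
    show "\<phi> b (act (gen_mon GZ) v) =
        (case b of BZ \<Rightarrow> \<phi> B1 v | BZX \<Rightarrow> \<phi> BX v + \<phi> BY v | _ \<Rightarrow> 0)"
      unfolding g by (cases b) (simp_all only: coord_mult coord_gen, simp_all)
    show "\<phi> b (u + v) = \<phi> b u + \<phi> b v"
    proof -
      obtain i where i: "i \<in> I" "\<phi> = (\<lambda>b v. lambda_coord q (h (\<beta> v) i) b)"
        using \<phi> by (auto simp: \<Phi>_def)
      obtain f g where "h (\<beta> u) i = lambda_class q f" "h (\<beta> v) i = lambda_class q g"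
        using h_class[OF i(1)] by blast
      then show ?thesis
        by (simp add: i(2) h_add[OF i(1)] lambda_class_add lambda_coord_class coord_add del: coord.simps)
    qed
  next
    fix v assume zero: "\<And>\<phi> b. \<phi> \<in> \<Phi> \<Longrightarrow> \<phi> b v = 0"
    have "h (\<beta> v) i = h (\<beta> 0) i" if i: "i \<in> I" for i
    proof -
      obtain f where f: "h (\<beta> v) i = lambda_class q f" using h_class[OF i] by blast
      have "coord q f b = 0" for b
        using zero[of "\<lambda>b v. lambda_coord q (h (\<beta> v) i) b" b] i
        by (simp add: \<Phi>_def f lambda_coord_class del: coord.simps)
      moreover obtain g where g: "h (\<beta> 0) i = lambda_class q g" using h_class[OF i] by blast
      moreover have "coord q g b = 0" for b
      proof -
        have "lambda_class q g = lambda_class q (free_const 0 * g)"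
          using h_act[OF i, of "free_const 0" 0] by (simp add: act_const g lambda_class_mult)
        then have "coord q g b = coord q (free_const 0 * g) b"
          unfolding lambda_class_eq_iff by blast
        then show ?thesis by (simp only: coord_const_mult mult_zero_left)
      qed
      ultimately show ?thesis by (simp add: f g lambda_class_eq_iff del: coord.simps)
    qed
    then have "h (\<beta> v) = h (\<beta> 0)" by (rule PiE_ext[OF h_closed h_closed])
    then have "\<beta> v = \<beta> 0" by (rule inj_onD[OF h(2) _ closed closed])
    then show "v = 0" by (simp only: inj)
  qed (simp_all add: assms(1) act_add act_scale)
  \<comment> \<open>Submodules correspond to invariant subspaces, as the generators generate the algebra.\<close>
  have submodule_image: "Module.submodule (\<beta> ` S) ?L M" if "invariant_subspace S" for S
  proof -
    have S: "vec.subspace S" using that by (simp add: invariant_subspace_def)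
    have act: "\<forall>v\<in>S. act f v \<in> S" for f
    proof (induction f rule: free_alg_induct)
      case (const a)
      show ?case using vec.subspace_scale[OF S] by (simp add: act_const)
    next
      case (gen g f)
      then show ?case
        using that by (cases g) (simp_all add: act_mult invariant_subspace_def)
    next
      case (add f g)
      then show ?case using vec.subspace_add[OF S] by (simp add: act_sum)
    qed
    show ?thesis
    proof (rule M.submoduleI)
      show "\<beta> ` S \<subseteq> carrier M" using closed by blast
      show "\<zero>\<^bsub>M\<^esub> \<in> \<beta> ` S" using vec.subspace_0[OF S] \<beta>_0 by (metis imageI)
      show "x \<oplus>\<^bsub>M\<^esub> y \<in> \<beta> ` S" if "x \<in> \<beta> ` S" "y \<in> \<beta> ` S" for x y
        using that vec.subspace_add[OF S] by (auto simp: \<beta>_add[symmetric])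
      show "a \<odot>\<^bsub>M\<^esub> x \<in> \<beta> ` S" if "a \<in> carrier ?L" "x \<in> \<beta> ` S" for a x
        using that act by (auto simp: carrier_lambda_alg \<beta>_act[symmetric])
    qed
  qed
  have vimage_invariant: "invariant_subspace (\<beta> -` N)" if N: "Module.submodule N ?L M" for N
  proof -
    note sub = submoduleD[OF N]
    have act: "act f v \<in> \<beta> -` N" if "v \<in> \<beta> -` N" for f v
      using that sub(4)[OF lambda_class_carrier] by (simp add: \<beta>_act)
    have "vec.subspace (\<beta> -` N)"
    proof (rule vec.subspaceI)
      show "c *s v \<in> \<beta> -` N" if "v \<in> \<beta> -` N" for c v
        using act[OF that, of "free_const c"] by (simp only: act_const)
    qed (simp_all add: \<beta>_0 \<beta>_add sub)
    then show ?thesis using act by (simp add: invariant_subspace_def)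
  qed
  have image_vimage: "\<beta> ` (\<beta> -` N) = N" if "Module.submodule N ?L M" for N
    using submoduleD(1)[OF that] bij by (auto simp: bij_betw_def)
  have image_UNIV: "\<beta> ` UNIV = carrier M" using bij by (simp add: bij_betw_def)
  have image_eq: "\<beta> ` S = \<beta> ` T \<longleftrightarrow> S = T" for S T
    by (rule inj_image_eq_iff) (use bij in \<open>simp add: bij_betw_def\<close>)
  have indecomposable: "A = {0} \<or> B = {0}"
    if A: "invariant_subspace A" and B: "invariant_subspace B" and AB: "A \<inter> B = {0}"
      and sum: "\<And>v. \<exists>a\<in>A. \<exists>b\<in>B. v = a + b" for A B
  proof -
    have "internal_direct_sum ?L M (\<beta> ` A) (\<beta> ` B)"
      unfolding internal_direct_sum_def
    proof (intro conjI submodule_image A B)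
      show "\<beta> ` A <+>\<^bsub>M\<^esub> \<beta> ` B = carrier M"
      proof
        show "carrier M \<subseteq> \<beta> ` A <+>\<^bsub>M\<^esub> \<beta> ` B"
        proof
          fix m assume "m \<in> carrier M"
          then obtain v where "m = \<beta> v" using surj by blast
          moreover obtain a b where "a \<in> A" "b \<in> B" "v = a + b" using sum[of v] by blast
          ultimately have "m = \<beta> a \<oplus>\<^bsub>M\<^esub> \<beta> b" "\<beta> a \<in> \<beta> ` A" "\<beta> b \<in> \<beta> ` B"
            by (simp_all add: \<beta>_add)
          then show "m \<in> \<beta> ` A <+>\<^bsub>M\<^esub> \<beta> ` B" unfolding set_add_def' by blast
        qed
      qed (use closed in \<open>auto simp: set_add_def'\<close>)
      have "\<beta> ` A \<inter> \<beta> ` B = \<beta> ` (A \<inter> B)"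
        by (rule image_Int[symmetric]) (use bij in \<open>simp add: bij_betw_def\<close>)
      then show "\<beta> ` A \<inter> \<beta> ` B = {\<zero>\<^bsub>M\<^esub>}" by (simp add: AB \<beta>_0)
    qed
    then have "\<beta> ` A = {\<zero>\<^bsub>M\<^esub>} \<or> \<beta> ` B = {\<zero>\<^bsub>M\<^esub>}"
      using assms(3) unfolding indecomposable_module_def by blast
    moreover have "{\<zero>\<^bsub>M\<^esub>} = \<beta> ` {0}" by (simp add: \<beta>_0)
    ultimately show ?thesis by (simp only: image_eq)
  qed
  have maximal: "maximal_submodule ?L M (\<beta> ` rad)"
    unfolding maximal_submodule_def
  proof (intro conjI allI impI)
    show "Module.submodule (\<beta> ` rad) ?L M"
      by (rule submodule_image[OF invariant_if_contains_rad[OF subspace_rad order_refl]])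
    show "\<beta> ` rad \<noteq> carrier M"
      using rad_proper[OF indecomposable] by (simp only: image_UNIV[symmetric] image_eq) simp
    fix N assume N: "Module.submodule N ?L M" "\<beta> ` rad \<subseteq> N"
    have "\<beta> -` N = rad \<or> \<beta> -` N = UNIV"
    proof (rule rad_maximal[OF indecomposable])
      show "vec.subspace (\<beta> -` N)"
        using vimage_invariant[OF N(1)] by (simp add: invariant_subspace_def)
      show "rad \<subseteq> \<beta> -` N" using N(2) by blast
    qed
    then have "\<beta> ` (\<beta> -` N) = \<beta> ` rad \<or> \<beta> ` (\<beta> -` N) = \<beta> ` UNIV" by (simp only: image_eq)
    then show "N = \<beta> ` rad \<or> N = carrier M"
      by (simp only: image_vimage[OF N(1)] image_UNIV)
  qed
  have least: "\<beta> ` rad \<subseteq> N" if N: "maximal_submodule ?L M N" for N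
  proof -
    have sub: "Module.submodule N ?L M" and max: "\<And>N'. Module.submodule N' ?L M \<Longrightarrow> N \<subseteq> N' \<Longrightarrow> N' = N \<or> N' = carrier M"
      using N by (simp_all add: maximal_submodule_def)
    have "rad \<subseteq> \<beta> -` N"
    proof (rule maximal_invariant_contains_rad[OF vimage_invariant[OF sub]])
      fix S assume S: "invariant_subspace S" "\<beta> -` N \<subseteq> S"
      have "N \<subseteq> \<beta> ` S" using image_mono[OF S(2), of \<beta>] by (simp only: image_vimage[OF sub])
      from max[OF submodule_image[OF S(1)] this]
      have "\<beta> ` S = \<beta> ` (\<beta> -` N) \<or> \<beta> ` S = \<beta> ` UNIV"
        by (simp only: image_vimage[OF sub] image_UNIV)
      then show "S = \<beta> -` N \<or> S = UNIV" by (simp only: image_eq)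
    qed
    then show ?thesis by blast
  qed
  show ?thesis
    by (rule M.local_if_radical_maximal)
      (simp only: M.radical_eq_if_least_maximal[OF maximal least] maximal)
qed

end
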